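(* Let $I$ be a set, and let $t_i$ ($i\in I$) be coordinates of variable points of the real projective line, on which $G=SL(2,\mathbb{R})/\{\pm 1\}$ acts simultaneously by $t_i\mapsto \frac{at_i+b}{ct_i+d}$. Endow $G$ with the Poisson structure determined by $$\{a,b\}=ab,\quad \{a,c\}=ac,\quad \{a,d\}=2bc,\quad \{b,c\}=0,\quad \{b,d\}=bd,\quad \{c,d\}=cd .$$ Then the $G$-covariant pre-Poisson brackets on the algebra of polynomials in the variables $t_i$, $i\in I$, are exactly the brackets determined by $$\{t_j,t_i\}=t_j^2-t_i^2-\lambda_{ij}(t_i-t_j)^2,\qquad i,j\in I,$$ with arbitrary constant coefficients satisfying $\lambda_{ij}=-\lambda_{ji}$. Moreover, such a pre-Poisson bracket is a Poisson bracket (i.e. satisfies the Jacobi identity) if and only if $$\lambda_{ij}\lambda_{jk}-\lambda_{ij}\lambda_{ik}-\lambda_{ik}\lambda_{jk}=-1$$ for any three different $i,j,k\in I$.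
   Context: A pre-Poisson bracket on a commutative algebra is an antisymmetric bilinear bracket which is a derivation in each argument (the Jacobi identity is not required). A pre-Poisson bracket on the polynomials in the $t_i$ is $G$-covariant if the action map is compatible with brackets: setting $t_i'=\frac{at_i+b}{ct_i+d}$ and computing $\{t_j',t_i'\}$ with the product bracket on $G\times X$ (the given bracket among $a,b,c,d$, the bracket $\{\cdot,\cdot\}$ among the $t_i$, and zero bracket between the functions $a,b,c,d$ and the $t_i$), the result equals the expression $\{t_j,t_i\}$ with every $t_k$ replaced by $t_k'$. Here $ad-bc=1$. The scalars (constants) may be taken real or complex. *)

theory Defs
  imports Complex_Main "HOL-Library.Poly_Mapping"
begin

type_synonym ('v, 'k) mpoly = "('v \<Rightarrow>\<^sub>0 nat) \<Rightarrow>\<^sub>0 'k"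

definition mconst :: "'k \<Rightarrow> ('v, 'k::comm_ring_1) mpoly"
  where "mconst c = Poly_Mapping.single 0 c"

definition mvar :: "'v \<Rightarrow> ('v, 'k::comm_ring_1) mpoly"
  where "mvar v = Poly_Mapping.single (Poly_Mapping.single v 1) 1"

text \<open>Substitution of \<open>x v\<close> for the variable \<open>v\<close>; coefficients enter the target ring
  through the structure map \<open>\<iota>\<close>.\<close>

definition msubst :: "('k::comm_ring_1 \<Rightarrow> 'r::comm_ring_1) \<Rightarrow> ('v \<Rightarrow> 'r) \<Rightarrow> ('v, 'k) mpoly \<Rightarrow> 'r"
  where "msubst \<iota> x p =
    (\<Sum>m\<in>Poly_Mapping.keys p. \<iota> (Poly_Mapping.lookup p m) *
       (\<Prod>v\<in>Poly_Mapping.keys m. x v ^ Poly_Mapping.lookup m v))"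

text \<open>A commutative \<open>'k\<close>-algebra is given by a commutative ring \<open>'r\<close> and a structure map
  \<open>\<iota> :: 'k \<Rightarrow> 'r\<close>.\<close>

definition derivation :: "('k::comm_ring_1 \<Rightarrow> 'r::comm_ring_1) \<Rightarrow> ('r \<Rightarrow> 'r) \<Rightarrow> bool"
  where "derivation \<iota> D \<longleftrightarrow>
    (\<forall>f g. D (f + g) = D f + D g) \<and>
    (\<forall>c f. D (\<iota> c * f) = \<iota> c * D f) \<and>
    (\<forall>f g. D (f * g) = D f * g + f * D g)"

definition pre_poisson :: "('k::comm_ring_1 \<Rightarrow> 'r::comm_ring_1) \<Rightarrow> ('r \<Rightarrow> 'r \<Rightarrow> 'r) \<Rightarrow> bool"
  where "pre_poisson \<iota> B \<longleftrightarrow>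
    (\<forall>f g. B f g = - B g f) \<and>
    (\<forall>f. derivation \<iota> (\<lambda>g. B f g)) \<and>
    (\<forall>g. derivation \<iota> (\<lambda>f. B f g))"

definition poisson :: "('k::comm_ring_1 \<Rightarrow> 'r::comm_ring_1) \<Rightarrow> ('r \<Rightarrow> 'r \<Rightarrow> 'r) \<Rightarrow> bool"
  where "poisson \<iota> B \<longleftrightarrow> pre_poisson \<iota> B \<and>
    (\<forall>f g h. B f (B g h) + B g (B h f) + B h (B f g) = 0)"


subsection \<open>Functions on \<open>G \<times> X\<close>\<close>

text \<open>The algebra \<open>k[a, b, c, d, t\<^sub>i, u\<^sub>i] / (a d - b c - 1, u\<^sub>i (c t\<^sub>i + d) - 1)\<close>:
  polynomial functions on \<open>SL\<^sub>2 \<times> X\<close>, with the denominators \<open>c t\<^sub>i + d\<close> of the action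
  inverted. The variable \<open>Den i\<close> stands for \<open>u\<^sub>i\<close>. The functions \<open>(a t\<^sub>i + b) / (c t\<^sub>i + d)\<close>
  are invariant under \<open>\<plusminus>1\<close>, so they are functions on \<open>SL\<^sub>2 / {\<plusminus>1} \<times> X\<close>.\<close>

datatype 'i coord = A | B | C | D | T 'i | Den 'i

definition action_ideal :: "('i coord, 'k::comm_ring_1) mpoly set"
  where "action_ideal = module.span (*)
    (insert (mvar A * mvar D - mvar B * mvar C - 1)
      (range (\<lambda>i. mvar (Den i) * (mvar C * mvar (T i) + mvar D) - 1)))"

lemma module_times: "module ((*) :: 'r \<Rightarrow> 'r \<Rightarrow> 'r::comm_ring_1)"
  by unfold_locales (simp_all add: algebra_simps)

lemma action_ideal_zero: "0 \<in> action_ideal"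
  and action_ideal_add: "p \<in> action_ideal \<Longrightarrow> q \<in> action_ideal \<Longrightarrow> p + q \<in> action_ideal"
  and action_ideal_neg: "p \<in> action_ideal \<Longrightarrow> - p \<in> action_ideal"
  and action_ideal_mult: "p \<in> action_ideal \<Longrightarrow> r * p \<in> action_ideal"
  unfolding action_ideal_def
  by (auto intro: module.span_zero module.span_add module.span_neg module.span_scale module_times)

definition funGX_rel :: "('i coord, 'k::comm_ring_1) mpoly \<Rightarrow> ('i coord, 'k) mpoly \<Rightarrow> bool"
  where "funGX_rel p q \<longleftrightarrow> p - q \<in> action_ideal"

lemma equivp_funGX_rel: "equivp funGX_rel"
proof (rule equivpI)
  show "reflp funGX_rel"
    by (simp add: reflp_def funGX_rel_def action_ideal_zero)
  show "symp funGX_rel"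
    by (auto simp: symp_def funGX_rel_def dest: action_ideal_neg)
  show "transp funGX_rel"
    by (auto simp: transp_def funGX_rel_def dest: action_ideal_add)
qed

quotient_type (overloaded) ('i, 'k) funGX = "('i coord, 'k::field) mpoly" / funGX_rel
  by (rule equivp_funGX_rel)

lemma msubst_superset:
  assumes "finite S" "Poly_Mapping.keys p \<subseteq> S" "\<iota> 0 = 0"
  shows "msubst \<iota> x p = (\<Sum>m\<in>S. \<iota> (Poly_Mapping.lookup p m) *
       (\<Prod>v\<in>Poly_Mapping.keys m. x v ^ Poly_Mapping.lookup m v))"
  unfolding msubst_def
  by (rule sum.mono_neutral_left) (use assms in \<open>auto simp: in_keys_iff\<close>)

lemma msubst_add:
  assumes "\<iota> 0 = 0" "\<And>a b. \<iota> (a + b) = \<iota> a + \<iota> b"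
  shows "msubst \<iota> x (p + q) = msubst \<iota> x p + msubst \<iota> x q"
proof -
  let ?S = "Poly_Mapping.keys p \<union> Poly_Mapping.keys q"
  have "msubst \<iota> x r = (\<Sum>m\<in>?S. \<iota> (Poly_Mapping.lookup r m) *
       (\<Prod>v\<in>Poly_Mapping.keys m. x v ^ Poly_Mapping.lookup m v))"
    if "r \<in> {p, q, p + q}" for r
    by (rule msubst_superset) (use that assms(1) keys_add[of p q] in auto)
  then show ?thesis
    by (simp add: lookup_add assms(2) distrib_right sum.distrib)
qed

lemma msubst_zero [simp]: "msubst \<iota> x 0 = 0"
  by (simp add: msubst_def)

lemma msubst_single:
  assumes "\<iota> 0 = 0"
  shows "msubst \<iota> x (Poly_Mapping.single m c) =
    \<iota> c * (\<Prod>v\<in>Poly_Mapping.keys m. x v ^ Poly_Mapping.lookup m v)"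
  using assms by (auto simp: msubst_def)

lemma monom_value_add:
  fixes x :: "'v \<Rightarrow> 'r::comm_ring_1"
  shows "(\<Prod>v\<in>Poly_Mapping.keys (m + n). x v ^ Poly_Mapping.lookup (m + n) v) =
    (\<Prod>v\<in>Poly_Mapping.keys m. x v ^ Poly_Mapping.lookup m v) *
    (\<Prod>v\<in>Poly_Mapping.keys n. x v ^ Poly_Mapping.lookup n v)"
proof -
  let ?S = "Poly_Mapping.keys m \<union> Poly_Mapping.keys n"
  have eq: "(\<Prod>v\<in>Poly_Mapping.keys r. x v ^ Poly_Mapping.lookup r v) =
      (\<Prod>v\<in>?S. x v ^ Poly_Mapping.lookup r v)" if "r \<in> {m, n, m + n}" for r
    by (rule prod.mono_neutral_left) (use that keys_add[of m n] in \<open>auto simp: in_keys_iff\<close>)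
  show ?thesis
    unfolding eq[of m, simplified] eq[of n, simplified] eq[of "m + n", simplified]
    by (simp add: lookup_add power_add prod.distrib)
qed

lemma mpoly_sum_singles:
  "p = (\<Sum>m\<in>Poly_Mapping.keys p. Poly_Mapping.single m (Poly_Mapping.lookup p m))"
  by (rule poly_mapping_eqI)
     (simp add: lookup_sum lookup_single when_def in_keys_iff)

lemma msubst_sum:
  assumes "\<iota> 0 = 0" "\<And>a b. \<iota> (a + b) = \<iota> a + \<iota> b"
  shows "msubst \<iota> x (sum f S) = (\<Sum>s\<in>S. msubst \<iota> x (f s))"
  by (induction S rule: infinite_finite_induct) (simp_all add: msubst_add[where \<iota> = \<iota>, OF assms])

lemma msubst_mult:
  assumes "\<iota> 0 = 0" "\<And>a b. \<iota> (a + b) = \<iota> a + \<iota> b" "\<And>a b. \<iota> (a * b) = \<iota> a * \<iota> b"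
  shows "msubst \<iota> x (p * q) = msubst \<iota> x p * msubst \<iota> x q"
proof -
  let ?s = "\<lambda>p m. Poly_Mapping.single m (Poly_Mapping.lookup p m)"
  note single = msubst_single[where \<iota> = \<iota>, OF assms(1)]
  have "msubst \<iota> x (p * q) =
      msubst \<iota> x ((\<Sum>m\<in>Poly_Mapping.keys p. ?s p m) * (\<Sum>n\<in>Poly_Mapping.keys q. ?s q n))"
    using mpoly_sum_singles[of p] mpoly_sum_singles[of q] by simp
  also have "\<dots> = (\<Sum>m\<in>Poly_Mapping.keys p. \<Sum>n\<in>Poly_Mapping.keys q.
      msubst \<iota> x (?s p m) * msubst \<iota> x (?s q n))"
    by (simp add: sum_product msubst_sum[where \<iota> = \<iota>, OF assms(1,2)] mult_single single
        monom_value_add assms(3) algebra_simps)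
  also have "\<dots> = msubst \<iota> x (\<Sum>m\<in>Poly_Mapping.keys p. ?s p m) *
      msubst \<iota> x (\<Sum>n\<in>Poly_Mapping.keys q. ?s q n)"
    by (simp add: sum_product msubst_sum[where \<iota> = \<iota>, OF assms(1,2)])
  also have "\<dots> = msubst \<iota> x p * msubst \<iota> x q"
    using mpoly_sum_singles[of p] mpoly_sum_singles[of q] by simp
  finally show ?thesis .
qed

lemma msubst_mvar:
  assumes "\<iota> 0 = 0" "\<iota> 1 = 1"
  shows "msubst \<iota> x (mvar v) = x v"
  by (simp add: mvar_def msubst_single assms)

lemma msubst_mconst:
  assumes "\<iota> 0 = 0"
  shows "msubst \<iota> x (mconst c) = \<iota> c"
  by (simp add: mconst_def msubst_single assms)

lemma one_notin_action_ideal: "(1 :: ('i coord, 'k::field) mpoly) \<notin> action_ideal"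
proof
  define x :: "'i coord \<Rightarrow> 'k"
    where "x = (\<lambda>v. case v of A \<Rightarrow> 1 | B \<Rightarrow> 0 | C \<Rightarrow> 0 | D \<Rightarrow> 1 | T i \<Rightarrow> 0 | Den i \<Rightarrow> 1)"
  define e where "e = msubst (\<lambda>c. c) x"
  have add: "e (p + q) = e p + e q" and mult: "e (p * q) = e p * e q" for p q
    by (simp_all add: e_def msubst_add msubst_mult)
  have var: "e (mvar v) = x v" for v
    by (simp add: e_def msubst_mvar)
  have one: "e 1 = 1"
    by (simp add: e_def msubst_single flip: single_one)
  have diff: "e (p - q) = e p - e q" for p q
    using add[of "p - q" q] by simp
  assume "1 \<in> (action_ideal :: ('i coord, 'k) mpoly set)"
  then have "e 1 = 0"
    unfolding action_ideal_def
  proof (induction rule: module.span_induct_alt[OF module_times, consumes 1])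
    case 1
    then show ?case by (simp add: e_def)
  next
    case (2 c g p)
    then have "e g = 0" by (auto simp: diff add mult var one x_def)
    then show ?case using 2 by (simp add: add mult)
  qed
  with one show False by simp
qed

instantiation funGX :: (type, field) comm_ring_1
begin

lift_definition zero_funGX :: "('a, 'b) funGX" is 0 .
lift_definition one_funGX :: "('a, 'b) funGX" is 1 .
lift_definition plus_funGX :: "('a, 'b) funGX \<Rightarrow> ('a, 'b) funGX \<Rightarrow> ('a, 'b) funGX" is "(+)"
  unfolding funGX_rel_def by (drule (1) action_ideal_add) (simp add: algebra_simps)
lift_definition uminus_funGX :: "('a, 'b) funGX \<Rightarrow> ('a, 'b) funGX" is uminus
  unfolding funGX_rel_def by (drule action_ideal_neg) simp
lift_definition minus_funGX :: "('a, 'b) funGX \<Rightarrow> ('a, 'b) funGX \<Rightarrow> ('a, 'b) funGX" is "(-)"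
  unfolding funGX_rel_def
  by (drule (1) action_ideal_add[OF _ action_ideal_neg]) (simp add: algebra_simps)
lift_definition times_funGX :: "('a, 'b) funGX \<Rightarrow> ('a, 'b) funGX \<Rightarrow> ('a, 'b) funGX" is "(*)"
proof -
  fix p p' q q' :: "('a coord, 'b) mpoly"
  assume "funGX_rel p p'" "funGX_rel q q'"
  then have "q * (p - p') + p' * (q - q') \<in> action_ideal"
    unfolding funGX_rel_def by (intro action_ideal_add action_ideal_mult)
  then show "funGX_rel (p * q) (p' * q')"
    by (simp add: funGX_rel_def algebra_simps)
qed

instance
proof
  fix x y z :: "('a, 'b) funGX"
  have eqI: "funGX_rel p q" if "p = q" for p q :: "('a coord, 'b) mpoly"
    using that by (simp add: funGX_rel_def action_ideal_zero)
  show "x * y * z = x * (y * z)" by transfer (rule eqI, rule mult.assoc)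
  show "x * y = y * x" by transfer (rule eqI, rule mult.commute)
  show "1 * x = x" by transfer (rule eqI, rule mult_1_left)
  show "x + y + z = x + (y + z)" by transfer (rule eqI, rule add.assoc)
  show "x + y = y + x" by transfer (rule eqI, rule add.commute)
  show "0 + x = x" by transfer (rule eqI, rule add_0_left)
  show "- x + x = 0" by transfer (rule eqI, rule left_minus)
  show "x - y = x + - y" by transfer (rule eqI, rule diff_conv_add_uminus)
  show "(x + y) * z = x * z + y * z" by transfer (rule eqI, rule distrib_right)
  have "\<not> funGX_rel 0 (1 :: ('a coord, 'b) mpoly)"
    using one_notin_action_ideal action_ideal_neg by (force simp: funGX_rel_def)
  then show "(0 :: ('a, 'b) funGX) \<noteq> 1" by transfer
qed

end

lift_definition gxconst :: "'k \<Rightarrow> ('i, 'k::field) funGX" is mconst .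

lift_definition gxvar :: "'i coord \<Rightarrow> ('i, 'k::field) funGX" is mvar .


subsection \<open>Covariance\<close>

text \<open>\<open>t\<^sub>i' = (a t\<^sub>i + b) / (c t\<^sub>i + d)\<close>\<close>

definition moved :: "'i \<Rightarrow> ('i, 'k::field) funGX"
  where "moved i = (gxvar A * gxvar (T i) + gxvar B) * gxvar (Den i)"

text \<open>\<open>P\<close> is the product of the Poisson structure of \<open>G\<close> and the bracket \<open>Br\<close> of \<open>X\<close>. Only values on
  \<open>a, b, c, d, t\<^sub>i\<close> are prescribed; the derivation property determines \<open>P\<close> on the inverses of
  \<open>c t\<^sub>i + d\<close>, hence everywhere.\<close>

definition product_bracket ::
    "(('i, 'k::field) mpoly \<Rightarrow> ('i, 'k) mpoly \<Rightarrow> ('i, 'k) mpoly) \<Rightarrow>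
     (('i, 'k) funGX \<Rightarrow> ('i, 'k) funGX \<Rightarrow> ('i, 'k) funGX) \<Rightarrow> bool"
  where "product_bracket Br P \<longleftrightarrow>
    (let a = gxvar A; b = gxvar B; c = gxvar C; d = gxvar D; t = (\<lambda>i. gxvar (T i)) in
      pre_poisson gxconst P \<and>
      P a b = a * b \<and> P a c = a * c \<and> P a d = 2 * b * c \<and>
      P b c = 0 \<and> P b d = b * d \<and> P c d = c * d \<and>
      (\<forall>i j. P (t i) (t j) = msubst gxconst t (Br (mvar i) (mvar j))) \<and>
      (\<forall>i. \<forall>g\<in>{a, b, c, d}. P g (t i) = 0))"

definition covariant ::
    "(('i, 'k::field) mpoly \<Rightarrow> ('i, 'k) mpoly \<Rightarrow> ('i, 'k) mpoly) \<Rightarrow> bool"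
  where "covariant Br \<longleftrightarrow>
    (\<exists>P. product_bracket Br P \<and>
      (\<forall>i j. P (moved j) (moved i) = msubst gxconst moved (Br (mvar j) (mvar i))))"


definition bracket_formula ::
    "('i \<Rightarrow> 'i \<Rightarrow> 'k::field) \<Rightarrow> (('i, 'k) mpoly \<Rightarrow> ('i, 'k) mpoly \<Rightarrow> ('i, 'k) mpoly) \<Rightarrow> bool"
  where "bracket_formula \<Lambda> Br \<longleftrightarrow>
    (\<forall>i j. Br (mvar j) (mvar i) =
      mvar j ^ 2 - mvar i ^ 2 - mconst (\<Lambda> i j) * (mvar i - mvar j) ^ 2)"

end

(*
  Evaluating covariance at points of G x X with coordinates in an arbitrary ring shows that
  Br t_j t_i - (t_j^2 - t_i^2) transforms under G as a form of weight 2 in t_i and in t_j, and of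
  weight 0 in the other variables. With Laurent monomials as coordinates, t -> 4 t forces total
  degree 2 and t -> - 1/t bounds the degrees in each variable, which leaves t_i^2, t_i t_j, t_j^2;
  translation then leaves multiples of (t_i - t_j)^2.
  The jacobiator is a derivation in each argument, so the Jacobi identity is a condition on the
  variables only, where the jacobiator is
  - 2 (1 + l_ij l_jk - l_ij l_ik - l_ik l_jk) (t_i - t_j) (t_j - t_k) (t_k - t_i).
*)
theory Submission
  imports Defs
begin

section \<open>Ring homomorphisms and polynomials\<close>

text \<open>In \<open>P_moved\<close> the bracket of two moved points is a common factor times the
  sum of \<open>Br\<close> and a term that comes from the bracket on \<open>G\<close> alone. As that
  term does not depend on \<open>Br\<close>, subtracting any one solution leaves a linear
  transformation law; \<open>moved_square_difference\<close> is the reason why t_j^2 - t_i^2 is such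
  a solution. The main obstacle lies in the converse: \<open>covariant\<close> asks for a product
  bracket to exist, on a quotient ring in which denominators are inverted. The bracket is therefore
  built on polynomials with values in the quotient ring, and it descends because a d - b c is a
  Casimir function and because the brackets with u_i are chosen so that u_i (c t_i + d) - 1 brackets
  to zero.\<close>

definition unital_ring_hom :: "('a::comm_ring_1 \<Rightarrow> 'b::comm_ring_1) \<Rightarrow> bool"
  where "unital_ring_hom h \<longleftrightarrow> h 0 = 0 \<and> h 1 = 1 \<and>
    (\<forall>x y. h (x + y) = h x + h y) \<and> (\<forall>x y. h (x * y) = h x * h y)"

lemma unital_ring_homI:
  assumes "h 0 = 0" "h 1 = 1" "\<And>x y. h (x + y) = h x + h y" "\<And>x y. h (x * y) = h x * h y"
  shows "unital_ring_hom h"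
  using assms by (simp add: unital_ring_hom_def)

context
  fixes h :: "'a::comm_ring_1 \<Rightarrow> 'b::comm_ring_1"
  assumes h: "unital_ring_hom h"
begin

lemma hom_zero: "h 0 = 0" and hom_one: "h 1 = 1"
  and hom_add: "h (x + y) = h x + h y" and hom_mult: "h (x * y) = h x * h y"
  using h by (auto simp: unital_ring_hom_def)

lemma hom_uminus: "h (- x) = - h x"
  using hom_add[of x "- x"] by (simp add: hom_zero eq_neg_iff_add_eq_0 add.commute)

lemma hom_diff: "h (x - y) = h x - h y"
  using hom_add[of x "- y"] by (simp add: hom_uminus)

lemma hom_power: "h (x ^ n) = h x ^ n"
  by (induction n) (simp_all add: hom_one hom_mult)

lemma hom_numeral: "h (numeral n) = numeral n"
proof -
  have "h (of_nat m) = of_nat m" for m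
    by (induction m) (simp_all add: hom_zero hom_one hom_add)
  then show ?thesis using of_nat_numeral by metis
qed

lemmas hom_simps = hom_zero hom_one hom_add hom_mult hom_uminus hom_diff hom_power hom_numeral

lemma unital_ring_hom_msubst: "unital_ring_hom (msubst h x)"
  using hom_zero hom_one hom_add hom_mult
  by (intro unital_ring_homI)
     (auto simp: msubst_add msubst_mult msubst_single simp flip: single_one)

lemma msubst_mvar': "msubst h x (mvar v) = x v"
  using hom_zero hom_one by (rule msubst_mvar)

lemma msubst_mconst': "msubst h x (mconst c) = h c"
  using hom_zero by (rule msubst_mconst)

end

lemma unital_ring_hom_comp:
  "unital_ring_hom g \<Longrightarrow> unital_ring_hom h \<Longrightarrow> unital_ring_hom (\<lambda>x. g (h x))"
  by (simp add: unital_ring_hom_def)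

lemma unital_ring_hom_id: "unital_ring_hom (\<lambda>x. x)"
  by (simp add: unital_ring_hom_def)

lemma unital_ring_hom_single_zero:
  "unital_ring_hom (Poly_Mapping.single (0 :: 'm::comm_monoid_add))"
  by (rule unital_ring_homI) (simp_all add: single_add mult_single)

lemma unital_ring_hom_mconst: "unital_ring_hom mconst"
  using unital_ring_hom_single_zero by (simp add: mconst_def[abs_def])

lemma mvar_power: "mvar v ^ n = Poly_Mapping.single (Poly_Mapping.single v n) 1"
  by (induction n) (simp_all add: mvar_def mult_single flip: single_add)

lemma single_eq_prod_mvar:
  "Poly_Mapping.single m c =
     mconst c * (\<Prod>v\<in>Poly_Mapping.keys m. mvar v ^ Poly_Mapping.lookup m v)"
proof -
  have "(\<Prod>v\<in>S. mvar v ^ Poly_Mapping.lookup m v :: ('a, 'b) mpoly) =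
      Poly_Mapping.single (\<Sum>v\<in>S. Poly_Mapping.single v (Poly_Mapping.lookup m v)) 1" for S
    by (induction S rule: infinite_finite_induct)
       (simp_all add: mvar_power mult_single single_one)
  then show ?thesis
    using mpoly_sum_singles[of m] by (simp add: mconst_def mult_single)
qed

text \<open>Constants and variables generate the polynomials as a ring. Every identity between
  homomorphisms, derivations or brackets below is reduced to generators by this rule.\<close>

lemma mpoly_induct [case_names const var add mult]:
  assumes const: "\<And>c. P (mconst c)" and var: "\<And>v. P (mvar v)"
    and add: "\<And>p q. P p \<Longrightarrow> P q \<Longrightarrow> P (p + q)" and mult: "\<And>p q. P p \<Longrightarrow> P q \<Longrightarrow> P (p * q)"
  shows "P p"
proof -
  have zero: "P 0" and one: "P 1"
    using const[of 0] const[of 1] by (simp_all add: mconst_def single_one)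
  have pow: "P (mvar v ^ n)" for v n
    by (induction n) (auto intro: one var mult)
  have prod: "P (\<Prod>v\<in>S. mvar v ^ f v)" for S f
    by (induction S rule: infinite_finite_induct) (auto intro: one pow mult)
  have "P (Poly_Mapping.single m c)" for m c
    unfolding single_eq_prod_mvar by (intro mult const prod)
  then have "P (\<Sum>m\<in>S. Poly_Mapping.single m (Poly_Mapping.lookup p m))" for S
    by (induction S rule: infinite_finite_induct) (auto intro: zero add)
  from this[of "Poly_Mapping.keys p"] show ?thesis
    by (simp only: mpoly_sum_singles[symmetric])
qed

lemma hom_msubst:
  assumes "unital_ring_hom g" "unital_ring_hom \<iota>"
  shows "g (msubst \<iota> x p) = msubst (\<lambda>c. g (\<iota> c)) (\<lambda>v. g (x v)) p"
  by (induction p rule: mpoly_induct)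
     (simp_all add: hom_simps[OF assms(1)] assms unital_ring_hom_comp msubst_mvar' msubst_mconst'
       hom_simps[OF unital_ring_hom_msubst[OF assms(2)]]
       hom_simps[OF unital_ring_hom_msubst[OF unital_ring_hom_comp[OF assms]]])

lemma msubst_mconst_mvar: "msubst mconst mvar p = p"
  by (induction p rule: mpoly_induct)
     (simp_all add: unital_ring_hom_mconst msubst_mvar' msubst_mconst'
       hom_simps[OF unital_ring_hom_msubst[OF unital_ring_hom_mconst]])


section \<open>Derivations with prescribed values on the variables\<close>

text \<open>A derivation along a homomorphism is the slope of a homomorphism to the dual numbers, so
  extending it from the variables is a special case of substitution.\<close>

datatype 'r dual = Dual (dual_base: 'r) (dual_slope: 'r)

instantiation dual :: (comm_ring_1) comm_ring_1
begin

definition "0 = Dual 0 0"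
definition "1 = Dual 1 0"
definition "x + y = Dual (dual_base x + dual_base y) (dual_slope x + dual_slope y)"
definition "- x = Dual (- dual_base x) (- dual_slope x)"
definition "x - y = Dual (dual_base x - dual_base y) (dual_slope x - dual_slope y)"
definition "x * y =
  Dual (dual_base x * dual_base y) (dual_slope x * dual_base y + dual_base x * dual_slope y)"

instance
  by standard
     (simp_all add: zero_dual_def one_dual_def plus_dual_def uminus_dual_def minus_dual_def
       times_dual_def algebra_simps)

end

definition ext_deriv ::
    "('k::comm_ring_1 \<Rightarrow> 'r::comm_ring_1) \<Rightarrow> ('v \<Rightarrow> 'r) \<Rightarrow> ('v \<Rightarrow> 'r) \<Rightarrow> ('v, 'k) mpoly \<Rightarrow> 'r"
  where "ext_deriv \<iota> x d p =
    dual_slope (msubst (\<lambda>c. Dual (\<iota> c) 0) (\<lambda>v. Dual (x v) (d v)) p)"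

text \<open>This is the biderivation \<Sum> (df/dv) (dg/dw) \<open>\<pi> v w\<close>, evaluated at
  \<open>x\<close>. Nesting two extensions avoids partial derivatives and a sum over a possibly
  infinite set of variables.\<close>

definition ext_bracket ::
    "('k::comm_ring_1 \<Rightarrow> 'r::comm_ring_1) \<Rightarrow> ('v \<Rightarrow> 'r) \<Rightarrow> ('v \<Rightarrow> 'v \<Rightarrow> 'r) \<Rightarrow>
      ('v, 'k) mpoly \<Rightarrow> ('v, 'k) mpoly \<Rightarrow> 'r"
  where "ext_bracket \<iota> x \<pi> f g = ext_deriv \<iota> x (\<lambda>w. ext_deriv \<iota> x (\<lambda>v. \<pi> v w) f) g"

context
  fixes \<iota> :: "'k::comm_ring_1 \<Rightarrow> 'r::comm_ring_1" and x :: "'v \<Rightarrow> 'r"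
  assumes \<iota>: "unital_ring_hom \<iota>"
begin

lemma unital_ring_hom_Dual: "unital_ring_hom (\<lambda>c. Dual (\<iota> c) 0)"
  using \<iota> by (auto simp: unital_ring_hom_def zero_dual_def one_dual_def plus_dual_def times_dual_def)

lemmas dual_hom = unital_ring_hom_msubst[OF unital_ring_hom_Dual]

lemma dual_base_msubst:
  "dual_base (msubst (\<lambda>c. Dual (\<iota> c) 0) (\<lambda>v. Dual (x v) (d v)) p) = msubst \<iota> x p"
proof -
  have "unital_ring_hom dual_base"
    by (rule unital_ring_homI)
       (simp_all add: zero_dual_def one_dual_def plus_dual_def times_dual_def)
  from hom_msubst[OF this unital_ring_hom_Dual, of "\<lambda>v. Dual (x v) (d v)" p] show ?thesis by simp
qed

lemma ext_deriv_mconst: "ext_deriv \<iota> x d (mconst c) = 0"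
  by (simp add: ext_deriv_def msubst_mconst' unital_ring_hom_Dual)

lemma ext_deriv_mvar: "ext_deriv \<iota> x d (mvar v) = d v"
  by (simp add: ext_deriv_def msubst_mvar' unital_ring_hom_Dual)

lemma ext_deriv_add: "ext_deriv \<iota> x d (p + q) = ext_deriv \<iota> x d p + ext_deriv \<iota> x d q"
  by (simp add: ext_deriv_def hom_add[OF dual_hom] plus_dual_def)

lemma ext_deriv_mult:
  "ext_deriv \<iota> x d (p * q) = ext_deriv \<iota> x d p * msubst \<iota> x q + msubst \<iota> x p * ext_deriv \<iota> x d q"
  by (simp add: ext_deriv_def hom_mult[OF dual_hom] times_dual_def dual_base_msubst)

lemmas ext_deriv_simps = ext_deriv_mconst ext_deriv_mvar ext_deriv_add ext_deriv_mult

lemmas msubst_hom_simps = hom_simps[OF unital_ring_hom_msubst[OF \<iota>]]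

text \<open>The first argument of \<open>ext_bracket\<close> enters only through the prescribed
  values of the outer derivation, so its sum and product rules come from linearity in these
  values.\<close>

lemma ext_deriv_linear:
  "ext_deriv \<iota> x (\<lambda>v. r * d v + s * e v) p = r * ext_deriv \<iota> x d p + s * ext_deriv \<iota> x e p"
  by (induction p rule: mpoly_induct) (simp_all add: ext_deriv_simps algebra_simps)

lemma ext_deriv_zero: "ext_deriv \<iota> x (\<lambda>v. 0) p = 0"
  using ext_deriv_linear[of 0 _ 0] by simp

lemma ext_bracket_mvar: "ext_bracket \<iota> x \<pi> (mvar v) (mvar w) = \<pi> v w"
  by (simp add: ext_bracket_def ext_deriv_mvar)

lemma ext_bracket_add2:
  "ext_bracket \<iota> x \<pi> f (p + q) = ext_bracket \<iota> x \<pi> f p + ext_bracket \<iota> x \<pi> f q"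
  by (simp add: ext_bracket_def ext_deriv_add)

lemma ext_bracket_mult2:
  "ext_bracket \<iota> x \<pi> f (p * q) =
    ext_bracket \<iota> x \<pi> f p * msubst \<iota> x q + msubst \<iota> x p * ext_bracket \<iota> x \<pi> f q"
  by (simp add: ext_bracket_def ext_deriv_mult)

lemma ext_bracket_mconst2: "ext_bracket \<iota> x \<pi> f (mconst c) = 0"
  by (simp add: ext_bracket_def ext_deriv_mconst)

lemma ext_bracket_mconst1: "ext_bracket \<iota> x \<pi> (mconst c) g = 0"
  by (simp add: ext_bracket_def ext_deriv_mconst ext_deriv_zero)

lemma ext_bracket_add1:
  "ext_bracket \<iota> x \<pi> (p + q) g = ext_bracket \<iota> x \<pi> p g + ext_bracket \<iota> x \<pi> q g"
  using ext_deriv_linear[of 1 "\<lambda>w. ext_deriv \<iota> x (\<lambda>v. \<pi> v w) p" 1]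
  by (simp add: ext_bracket_def ext_deriv_add)

lemma ext_bracket_mult1:
  "ext_bracket \<iota> x \<pi> (p * q) g =
    ext_bracket \<iota> x \<pi> p g * msubst \<iota> x q + msubst \<iota> x p * ext_bracket \<iota> x \<pi> q g"
  using ext_deriv_linear[of "msubst \<iota> x q" "\<lambda>w. ext_deriv \<iota> x (\<lambda>v. \<pi> v w) p"
      "msubst \<iota> x p" "\<lambda>w. ext_deriv \<iota> x (\<lambda>v. \<pi> v w) q" g]
  by (simp add: ext_bracket_def ext_deriv_mult mult.commute)

lemma ext_bracket_antisym:
  assumes "\<And>v w. \<pi> v w = - \<pi> w v"
  shows "ext_bracket \<iota> x \<pi> f g = - ext_bracket \<iota> x \<pi> g f"
proof (induction f arbitrary: g rule: mpoly_induct)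
  case (var v)
  show ?case
    by (induction g rule: mpoly_induct)
       (simp_all add: ext_bracket_mvar ext_bracket_add1 ext_bracket_mult1 ext_bracket_mconst1
         ext_bracket_add2 ext_bracket_mult2 ext_bracket_mconst2 assms[of v])
qed (simp_all add: ext_bracket_add1 ext_bracket_mult1 ext_bracket_mconst1
         ext_bracket_add2 ext_bracket_mult2 ext_bracket_mconst2)

end


section \<open>Pre-Poisson brackets\<close>

lemma pre_poissonI:
  assumes antisym: "\<And>f g. Br f g = - Br g f"
    and "\<And>f g h. Br f (g + h) = Br f g + Br f h"
    and "\<And>c f g. Br f (\<iota> c * g) = \<iota> c * Br f g"
    and "\<And>f g h. Br f (g * h) = Br f g * h + g * Br f h"
  shows "pre_poisson \<iota> Br"
proof -
  have "derivation \<iota> (\<lambda>g. Br f g)" for f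
    using assms(2-4) by (simp add: derivation_def)
  moreover have "derivation \<iota> (\<lambda>f. Br f g)" for g
    using assms(2-4)[of g] by (simp add: derivation_def antisym[of _ g])
  ultimately show ?thesis
    unfolding pre_poisson_def using antisym by blast
qed

context
  fixes \<iota> :: "'k::comm_ring_1 \<Rightarrow> 'r::comm_ring_1" and Br :: "'r \<Rightarrow> 'r \<Rightarrow> 'r"
  assumes pp: "pre_poisson \<iota> Br"
begin

lemma pp_antisym: "Br f g = - Br g f"
  using pp unfolding pre_poisson_def by blast

lemma pp_add1: "Br (f + g) h = Br f h + Br g h"
  and pp_add2: "Br h (f + g) = Br h f + Br h g"
  and pp_mult1: "Br (f * g) h = Br f h * g + f * Br g h"
  and pp_mult2: "Br h (f * g) = Br h f * g + f * Br h g"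
  and pp_scale1: "Br (\<iota> c * f) h = \<iota> c * Br f h"
  and pp_scale2: "Br h (\<iota> c * f) = \<iota> c * Br h f"
  using pp unfolding pre_poisson_def derivation_def by blast+

lemma pp_one1: "Br 1 h = 0" and pp_one2: "Br h 1 = 0"
  using pp_mult1[of 1 1] pp_mult2[of _ 1 1] by auto

lemma pp_const1: "Br (\<iota> c) h = 0" and pp_const2: "Br h (\<iota> c) = 0"
  using pp_scale1[of c 1] pp_scale2[of _ c 1] by (simp_all add: pp_one1 pp_one2)

lemma pp_zero1: "Br 0 h = 0" and pp_zero2: "Br h 0 = 0"
  using pp_add1[of 0 0] pp_add2[of _ 0 0] by auto

lemma pp_uminus1: "Br (- f) h = - Br f h" and pp_uminus2: "Br h (- f) = - Br h f"
  using pp_add1[of f "- f"] pp_add2[of _ f "- f"]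
  by (simp_all add: pp_zero1 pp_zero2 eq_neg_iff_add_eq_0 add.commute)

lemma pp_diff1: "Br (f - g) h = Br f h - Br g h" and pp_diff2: "Br h (f - g) = Br h f - Br h g"
  using pp_add1[of f "- g"] pp_add2[of _ f "- g"] by (simp_all add: pp_uminus1 pp_uminus2)

lemma pp_square1: "Br (f ^ 2) h = 2 * f * Br f h" and pp_square2: "Br h (f ^ 2) = 2 * f * Br h f"
  by (simp_all add: power2_eq_square pp_mult1 pp_mult2 algebra_simps)

lemmas pp_simps = pp_add1 pp_add2 pp_mult1 pp_mult2 pp_const1 pp_const2 pp_zero1 pp_zero2
  pp_one1 pp_one2 pp_uminus1 pp_uminus2 pp_diff1 pp_diff2 pp_square1 pp_square2

end

lemma pre_poisson_eqI:
  assumes pp: "pre_poisson mconst Br" "pre_poisson mconst Br'"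
    and eq: "\<And>v w. Br (mvar v) (mvar w) = Br' (mvar v) (mvar w)"
  shows "Br = Br'"
proof (intro ext)
  fix f g
  show "Br f g = Br' f g"
  proof (induction f arbitrary: g rule: mpoly_induct)
    case (var v)
    show ?case
      by (induction g rule: mpoly_induct) (simp_all add: pp_simps[OF pp(1)] pp_simps[OF pp(2)] eq)
  qed (simp_all add: pp_simps[OF pp(1)] pp_simps[OF pp(2)])
qed

lemma pre_poisson_ext_bracket:
  assumes "\<And>v w. \<pi> v w = - \<pi> w v"
  shows "pre_poisson mconst (ext_bracket mconst mvar \<pi>)"
proof (rule pre_poissonI)
  show "ext_bracket mconst mvar \<pi> f g = - ext_bracket mconst mvar \<pi> g f" for f g
    by (rule ext_bracket_antisym[OF unital_ring_hom_mconst assms])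
qed (simp_all add: ext_bracket_add2 ext_bracket_mult2 ext_bracket_mconst2 unital_ring_hom_mconst
      msubst_mconst_mvar)


section \<open>Functions on \<open>G \<times> X\<close>\<close>

lemma action_ideal_induct [consumes 1, case_names zero det den]:
  assumes "p \<in> action_ideal"
    and "P 0"
    and "\<And>r p. P p \<Longrightarrow> P (r * (mvar A * mvar D - mvar B * mvar C - 1) + p)"
    and "\<And>r i p. P p \<Longrightarrow> P (r * (mvar (Den i) * (mvar C * mvar (T i) + mvar D) - 1) + p)"
  shows "P p"
  using assms(1) unfolding action_ideal_def
proof (induction rule: module.span_induct_alt[OF module_times, consumes 1])
  case (2 c x y)
  then show ?case using assms(3,4) by auto
qed (rule assms(2))

lemma unital_ring_hom_abs_funGX: "unital_ring_hom abs_funGX"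
  by (rule unital_ring_homI)
     (simp_all add: zero_funGX.abs_eq one_funGX.abs_eq plus_funGX.abs_eq times_funGX.abs_eq)

lemmas abs_funGX_simps = hom_simps[OF unital_ring_hom_abs_funGX]

lemma unital_ring_hom_gxconst: "unital_ring_hom gxconst"
  using unital_ring_hom_comp[OF unital_ring_hom_abs_funGX unital_ring_hom_mconst]
  by (simp add: gxconst.abs_eq[abs_def])

text \<open>The quotient map is evaluation at the generic point, so
  \<open>ext_bracket gxconst gxvar\<close> is a biderivation along the quotient map.\<close>

lemma abs_funGX_eq_msubst: "abs_funGX p = msubst gxconst gxvar p"
  using hom_msubst[OF unital_ring_hom_abs_funGX unital_ring_hom_mconst, of mvar p]
  by (simp add: msubst_mconst_mvar gxconst.abs_eq[abs_def] gxvar.abs_eq[abs_def])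

lemma abs_rep_funGX: "abs_funGX (rep_funGX f) = f"
  by (rule Quotient3_abs_rep[OF Quotient3_funGX])

lemma rep_abs_funGX: "rep_funGX (abs_funGX p) - p \<in> action_ideal"
  using funGX.abs_eq_iff[of "rep_funGX (abs_funGX p)" p] by (simp add: abs_rep_funGX funGX_rel_def)

lemma abs_funGX_eq_zero: "p \<in> action_ideal \<Longrightarrow> abs_funGX p = 0"
  by (simp add: zero_funGX.abs_eq funGX.abs_eq_iff funGX_rel_def)

lemma det_relation: "gxvar A * gxvar D - gxvar B * gxvar C = 1"
proof -
  have "mvar A * mvar D - mvar B * mvar C - 1 \<in> action_ideal"
    unfolding action_ideal_def by (intro module.span_base[OF module_times]) simp
  from abs_funGX_eq_zero[OF this] show ?thesis
    by (simp add: abs_funGX_simps gxvar.abs_eq)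
qed

lemma den_relation: "gxvar (Den i) * (gxvar C * gxvar (T i) + gxvar D) = 1"
proof -
  have "mvar (Den i) * (mvar C * mvar (T i) + mvar D) - 1 \<in> action_ideal"
    unfolding action_ideal_def by (intro module.span_base[OF module_times]) simp
  from abs_funGX_eq_zero[OF this] show ?thesis
    by (simp add: abs_funGX_simps gxvar.abs_eq)
qed

section \<open>Evaluation at points of G x X with coordinates in any commutative ring\<close>

definition eval_funGX :: "('k::field \<Rightarrow> 'r::comm_ring_1) \<Rightarrow> ('i coord \<Rightarrow> 'r) \<Rightarrow> ('i, 'k) funGX \<Rightarrow> 'r"
  where "eval_funGX \<iota> x f = msubst \<iota> x (rep_funGX f)"

context
  fixes \<iota> :: "'k::field \<Rightarrow> 'r::comm_ring_1" and x :: "'i coord \<Rightarrow> 'r"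
  assumes \<iota>: "unital_ring_hom \<iota>"
    and det: "x A * x D - x B * x C = 1"
    and den: "\<And>i. x (Den i) * (x C * x (T i) + x D) = 1"
begin

text \<open>The generators of the ideal vanish at a point that satisfies the relations, so the
  choice of the representative does not matter.\<close>

lemma eval_funGX_abs: "eval_funGX \<iota> x (abs_funGX p) = msubst \<iota> x p"
proof -
  note [simp] = msubst_hom_simps[OF \<iota>] msubst_mvar'[OF \<iota>]
  have "msubst \<iota> x q = 0" if "q \<in> action_ideal" for q
    using that by (induction rule: action_ideal_induct) (simp_all add: det den)
  from this[OF rep_abs_funGX] show ?thesis
    by (simp add: eval_funGX_def)
qed

lemma eval_funGX_const: "eval_funGX \<iota> x (gxconst c) = \<iota> c"
  by (simp add: gxconst.abs_eq eval_funGX_abs msubst_mconst'[OF \<iota>])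

lemma eval_funGX_var: "eval_funGX \<iota> x (gxvar v) = x v"
  by (simp add: gxvar.abs_eq eval_funGX_abs msubst_mvar'[OF \<iota>])

lemma unital_ring_hom_eval_funGX: "unital_ring_hom (eval_funGX \<iota> x)"
proof (rule unital_ring_homI)
  fix f g :: "('i, 'k) funGX"
  note [simp] = msubst_hom_simps[OF \<iota>] eval_funGX_abs
  show "eval_funGX \<iota> x 0 = 0" "eval_funGX \<iota> x 1 = 1"
    by (simp_all add: zero_funGX.abs_eq one_funGX.abs_eq)
  show "eval_funGX \<iota> x (f + g) = eval_funGX \<iota> x f + eval_funGX \<iota> x g"
    using eval_funGX_abs[of "rep_funGX f + rep_funGX g"]
    by (simp add: abs_funGX_simps abs_rep_funGX eval_funGX_def)
  show "eval_funGX \<iota> x (f * g) = eval_funGX \<iota> x f * eval_funGX \<iota> x g"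
    using eval_funGX_abs[of "rep_funGX f * rep_funGX g"]
    by (simp add: abs_funGX_simps abs_rep_funGX eval_funGX_def)
qed

lemma eval_funGX_msubst:
  "eval_funGX \<iota> x (msubst gxconst y p) = msubst \<iota> (\<lambda>v. eval_funGX \<iota> x (y v)) p"
  using hom_msubst[OF unital_ring_hom_eval_funGX unital_ring_hom_gxconst]
  by (simp add: eval_funGX_const)

end


subsection \<open>The product bracket\<close>

text \<open>The final 0 is the prescribed value for \<open>B\<close> with \<open>C\<close>, for a
  group coordinate with itself, and for a group coordinate with \<open>T i\<close>. Brackets with
  \<open>Den i\<close> are supplied by \<open>extend_den\<close>.\<close>

fun coord_bracket :: "('i \<Rightarrow> 'i \<Rightarrow> ('i, 'k::field) funGX) \<Rightarrow> 'i coord \<Rightarrow> 'i coord \<Rightarrow> ('i, 'k) funGX"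
  where
    "coord_bracket \<beta> A B = gxvar A * gxvar B"
  | "coord_bracket \<beta> B A = - (gxvar A * gxvar B)"
  | "coord_bracket \<beta> A C = gxvar A * gxvar C"
  | "coord_bracket \<beta> C A = - (gxvar A * gxvar C)"
  | "coord_bracket \<beta> A D = 2 * gxvar B * gxvar C"
  | "coord_bracket \<beta> D A = - (2 * gxvar B * gxvar C)"
  | "coord_bracket \<beta> B D = gxvar B * gxvar D"
  | "coord_bracket \<beta> D B = - (gxvar B * gxvar D)"
  | "coord_bracket \<beta> C D = gxvar C * gxvar D"
  | "coord_bracket \<beta> D C = - (gxvar C * gxvar D)"
  | "coord_bracket \<beta> (T i) (T j) = \<beta> i j"
  | "coord_bracket \<beta> _ _ = 0"

text \<open>The values of a derivation on the \<open>u\<^sub>i\<close> are forced by \<open>u\<^sub>i (c t\<^sub>i + d) = 1\<close>.\<close>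

fun extend_den :: "('i coord \<Rightarrow> ('i, 'k::field) funGX) \<Rightarrow> 'i coord \<Rightarrow> ('i, 'k) funGX"
  where
    "extend_den F (Den i) =
      - (gxvar (Den i))\<^sup>2 * (gxvar (T i) * F C + gxvar C * F (T i) + F D)"
  | "extend_den F v = F v"

definition den_bracket :: "('i \<Rightarrow> 'i \<Rightarrow> ('i, 'k::field) funGX) \<Rightarrow> 'i coord \<Rightarrow> 'i coord \<Rightarrow> ('i, 'k) funGX"
  where "den_bracket \<beta> v w = extend_den (\<lambda>p. extend_den (coord_bracket \<beta> p) w) v"

definition lifted_bracket ::
    "('i \<Rightarrow> 'i \<Rightarrow> ('i, 'k::field) funGX) \<Rightarrow> ('i, 'k) funGX \<Rightarrow> ('i, 'k) funGX \<Rightarrow> ('i, 'k) funGX"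
  where "lifted_bracket \<beta> f g =
    ext_bracket gxconst gxvar (den_bracket \<beta>) (rep_funGX f) (rep_funGX g)"

context
  fixes \<beta> :: "'i \<Rightarrow> 'i \<Rightarrow> ('i, 'k::field) funGX"
  assumes \<beta>: "\<And>i j. \<beta> i j = - \<beta> j i"
begin

abbreviation "poly_bracket \<equiv> ext_bracket gxconst gxvar (den_bracket \<beta>)"

lemma coord_bracket_antisym: "coord_bracket \<beta> v w = - coord_bracket \<beta> w v"
proof (cases "\<exists>i j. v = T i \<and> w = T j")
  case True
  then show ?thesis by (auto intro: \<beta>)
next
  case False
  then show ?thesis by (cases v; cases w) simp_all
qed

text \<open>Extending in either slot first gives the same bilinear expression. This is what carries
  antisymmetry from the coordinates to the inverses.\<close>

lemma extend_den_swap: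
  "extend_den (\<lambda>p. extend_den (\<lambda>q. F p q) w) v = extend_den (\<lambda>q. extend_den (\<lambda>p. F p q) v) w"
  by (cases v; cases w) (simp_all add: algebra_simps)

lemma extend_den_uminus: "extend_den (\<lambda>p. - F p) v = - extend_den F v"
  by (cases v) (simp_all add: algebra_simps)

lemma den_bracket_antisym: "den_bracket \<beta> v w = - den_bracket \<beta> w v"
proof -
  have "den_bracket \<beta> v w = extend_den (\<lambda>q. extend_den (\<lambda>p. - coord_bracket \<beta> q p) v) w"
    unfolding den_bracket_def extend_den_swap[of _ w v] by (simp flip: coord_bracket_antisym)
  then show ?thesis
    by (simp add: den_bracket_def extend_den_uminus)
qed

lemmas poly_bracket_simps =
  ext_bracket_add1[OF unital_ring_hom_gxconst] ext_bracket_add2[OF unital_ring_hom_gxconst]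
  ext_bracket_mult1[OF unital_ring_hom_gxconst] ext_bracket_mult2[OF unital_ring_hom_gxconst]
  ext_bracket_mconst1[OF unital_ring_hom_gxconst] ext_bracket_mconst2[OF unital_ring_hom_gxconst]
  ext_bracket_mvar[OF unital_ring_hom_gxconst]

lemma poly_bracket_antisym: "poly_bracket f g = - poly_bracket g f"
  by (rule ext_bracket_antisym[OF unital_ring_hom_gxconst den_bracket_antisym])

lemma poly_bracket_diff1: "poly_bracket (p - q) g = poly_bracket p g - poly_bracket q g"
  using ext_bracket_add1[OF unital_ring_hom_gxconst, of _ "den_bracket \<beta>" "p - q" q g] by simp

lemma poly_bracket_one1: "poly_bracket 1 g = 0"
  using ext_bracket_mconst1[OF unital_ring_hom_gxconst, of _ _ 1 g]
  by (simp add: mconst_def single_one)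

lemma poly_bracket_zeroI:
  assumes "\<And>w. poly_bracket f (mvar w) = 0"
  shows "poly_bracket f g = 0"
  by (induction g rule: mpoly_induct) (simp_all add: assms poly_bracket_simps)

text \<open>The determinant is a Casimir function of the bracket on \<open>G\<close>, and it
  commutes with the coordinates of \<open>X\<close>.\<close>

lemma poly_bracket_det: "poly_bracket (mvar A * mvar D - mvar B * mvar C - 1) g = 0"
proof (rule poly_bracket_zeroI)
  show "poly_bracket (mvar A * mvar D - mvar B * mvar C - 1) (mvar w) = 0" for w
    by (cases w)
       (simp_all add: poly_bracket_diff1 poly_bracket_one1 poly_bracket_simps den_bracket_def
         msubst_mvar'[OF unital_ring_hom_gxconst] algebra_simps)
qed

lemma poly_bracket_den: "poly_bracket (mvar (Den i) * (mvar C * mvar (T i) + mvar D) - 1) g = 0"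
proof (rule poly_bracket_zeroI)
  fix w
  define u t c M where "u = (gxvar (Den i) :: ('i, 'k) funGX)"
    and "t = (gxvar (T i) :: ('i, 'k) funGX)" and "c = (gxvar C :: ('i, 'k) funGX)"
    and "M = c * t + (gxvar D :: ('i, 'k) funGX)"
  \<comment> \<open>\<open>Q\<close> is the bracket of \<open>M\<close> with \<open>w\<close>, by
    the Leibniz rule.\<close>
  define Q where "Q = t * den_bracket \<beta> C w + c * den_bracket \<beta> (T i) w + den_bracket \<beta> D w"
  have uM: "u * M = 1"
    using den_relation[of i] by (simp add: u_def M_def t_def c_def)
  have "poly_bracket (mvar (Den i) * (mvar C * mvar (T i) + mvar D) - 1) (mvar w) =
      - u\<^sup>2 * Q * M + u * Q"
    by (simp add: poly_bracket_diff1 poly_bracket_one1 poly_bracket_simps Q_def u_def M_def t_def c_def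
         msubst_mvar'[OF unital_ring_hom_gxconst] msubst_hom_simps[OF unital_ring_hom_gxconst]
         den_bracket_def algebra_simps)
  also have "\<dots> = u * Q * (1 - u * M)"
    by (simp add: algebra_simps power2_eq_square)
  finally show "poly_bracket (mvar (Den i) * (mvar C * mvar (T i) + mvar D) - 1) (mvar w) = 0"
    by (simp add: uM)
qed

text \<open>In the bracket of r x with g, for a generator x, one Leibniz term contains x, which is
  zero in the quotient, and the other contains the bracket of x with g, which is zero by the two
  preceding lemmas.\<close>

lemma poly_bracket_ideal:
  assumes "p \<in> action_ideal"
  shows "poly_bracket p g = 0"
  using assms
proof (induction rule: action_ideal_induct)
  case zero
  show ?case using poly_bracket_diff1[of 0 0] by simp
qed (simp_all add: poly_bracket_simps poly_bracket_det poly_bracket_den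
      msubst_mvar'[OF unital_ring_hom_gxconst] msubst_hom_simps[OF unital_ring_hom_gxconst]
      det_relation den_relation)

text \<open>Independence of the representative is known in the first argument; antisymmetry
  transfers it to the second.\<close>

lemma lifted_bracket_abs: "lifted_bracket \<beta> (abs_funGX p) (abs_funGX q) = poly_bracket p q"
proof -
  have left: "poly_bracket (rep_funGX (abs_funGX p)) g = poly_bracket p g" for p g
    using poly_bracket_ideal[OF rep_abs_funGX] by (simp add: poly_bracket_diff1)
  show ?thesis
    unfolding lifted_bracket_def left poly_bracket_antisym[of p] by (simp add: left)
qed

lemma pre_poisson_lifted_bracket: "pre_poisson gxconst (lifted_bracket \<beta>)"
proof (rule pre_poissonI)
  fix f g h :: "('i, 'k) funGX" and k
  obtain p q r where [simp]: "f = abs_funGX p" "g = abs_funGX q" "h = abs_funGX r"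
    using abs_rep_funGX by metis
  show "lifted_bracket \<beta> f g = - lifted_bracket \<beta> g f"
    using poly_bracket_antisym[of p q] by (simp add: lifted_bracket_abs)
  show "lifted_bracket \<beta> f (g + h) = lifted_bracket \<beta> f g + lifted_bracket \<beta> f h"
    by (simp add: lifted_bracket_abs poly_bracket_simps flip: abs_funGX_simps)
  show "lifted_bracket \<beta> f (gxconst k * g) = gxconst k * lifted_bracket \<beta> f g"
    by (simp add: lifted_bracket_abs poly_bracket_simps gxconst.abs_eq flip: abs_funGX_simps)
       (simp add: abs_funGX_eq_msubst)
  show "lifted_bracket \<beta> f (g * h) = lifted_bracket \<beta> f g * h + g * lifted_bracket \<beta> f h"
    by (simp add: lifted_bracket_abs poly_bracket_simps flip: hom_mult[OF unital_ring_hom_abs_funGX])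
       (simp add: abs_funGX_eq_msubst)
qed

lemma lifted_bracket_var: "lifted_bracket \<beta> (gxvar v) (gxvar w) = den_bracket \<beta> v w"
  by (simp add: gxvar.abs_eq lifted_bracket_abs poly_bracket_simps)

end

text \<open>Supplies the witness that the existential quantifier in \<open>covariant\<close>
  demands.\<close>

lemma product_bracket_exists:
  assumes "pre_poisson mconst Br"
  shows "\<exists>P. product_bracket Br P"
proof
  define \<beta> where "\<beta> i j = msubst gxconst (\<lambda>i. gxvar (T i)) (Br (mvar i) (mvar j))" for i j
  have "\<beta> i j = - \<beta> j i" for i j
    unfolding \<beta>_def pp_antisym[OF assms, of "mvar i"]
    by (simp add: msubst_hom_simps[OF unital_ring_hom_gxconst])
  note lift = pre_poisson_lifted_bracket[OF this] lifted_bracket_var[OF this]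
  show "product_bracket Br (lifted_bracket \<beta>)"
    by (auto simp: product_bracket_def Let_def lift den_bracket_def \<beta>_def)
qed


subsection \<open>The bracket of two moved points\<close>

text \<open>\<open>funGX\<close> is only a ring type, so the inverse of 2 has to come from the
  scalars.\<close>

lemma funGX_eq_uminus_imp_zero:
  fixes f :: "('i, 'k::field_char_0) funGX"
  assumes "f = - f"
  shows "f = 0"
proof -
  have "gxconst (1 / 2) * 2 = (1 :: ('i, 'k) funGX)"
    using hom_mult[OF unital_ring_hom_gxconst, of "1 / 2 :: 'k" 2, symmetric]
    by (simp add: hom_simps[OF unital_ring_hom_gxconst])
  then have "f = gxconst (1 / 2) * (f + f)"
    by (metis mult.assoc mult_2 mult_1)
  then show ?thesis
    using assms by (metis add.right_inverse mult_zero_right)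
qed

context
  fixes Br :: "('i, 'k::field_char_0) mpoly \<Rightarrow> ('i, 'k) mpoly \<Rightarrow> ('i, 'k) mpoly"
    and P :: "('i, 'k) funGX \<Rightarrow> ('i, 'k) funGX \<Rightarrow> ('i, 'k) funGX"
  assumes P: "product_bracket Br P"
begin

lemma pre_poisson_product_bracket: "pre_poisson gxconst P"
  using P by (simp add: product_bracket_def Let_def)

lemmas P_simps = pp_simps[OF pre_poisson_product_bracket]
lemmas P_antisym = pp_antisym[OF pre_poisson_product_bracket]

lemma P_coord:
  "P (gxvar A) (gxvar B) = gxvar A * gxvar B" "P (gxvar A) (gxvar C) = gxvar A * gxvar C"
  "P (gxvar A) (gxvar D) = 2 * gxvar B * gxvar C" "P (gxvar B) (gxvar C) = 0"
  "P (gxvar B) (gxvar D) = gxvar B * gxvar D" "P (gxvar C) (gxvar D) = gxvar C * gxvar D"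
  "P (gxvar A) (gxvar (T i)) = 0" "P (gxvar B) (gxvar (T i)) = 0"
  "P (gxvar C) (gxvar (T i)) = 0" "P (gxvar D) (gxvar (T i)) = 0"
  using P by (simp_all add: product_bracket_def Let_def)

lemma P_coord':
  "P (gxvar B) (gxvar A) = - (gxvar A * gxvar B)" "P (gxvar C) (gxvar A) = - (gxvar A * gxvar C)"
  "P (gxvar D) (gxvar A) = - (2 * gxvar B * gxvar C)" "P (gxvar C) (gxvar B) = 0"
  "P (gxvar D) (gxvar B) = - (gxvar B * gxvar D)" "P (gxvar D) (gxvar C) = - (gxvar C * gxvar D)"
  "P (gxvar (T i)) (gxvar A) = 0" "P (gxvar (T i)) (gxvar B) = 0"
  "P (gxvar (T i)) (gxvar C) = 0" "P (gxvar (T i)) (gxvar D) = 0"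
  using P_coord P_antisym[of "gxvar B" "gxvar A"] P_antisym[of "gxvar C" "gxvar A"]
    P_antisym[of "gxvar D" "gxvar A"] P_antisym[of "gxvar C" "gxvar B"]
    P_antisym[of "gxvar D" "gxvar B"] P_antisym[of "gxvar D" "gxvar C"]
    P_antisym[of "gxvar (T i)"]
  by simp_all

lemma P_self: "P f f = 0"
  using P_antisym by (rule funGX_eq_uminus_imp_zero)

text \<open>This is the quotient rule. The coefficient of \<open>P t x\<close> is a (c t + d) - c (a
  t + b) = a d - b c = 1.\<close>

lemma P_moved_left:
  fixes x :: "('i, 'k) funGX" and i :: 'i
  defines "a \<equiv> gxvar A" and "b \<equiv> gxvar B" and "c \<equiv> gxvar C" and "d \<equiv> gxvar D"
    and "t \<equiv> gxvar (T i)" and "u \<equiv> gxvar (Den i)"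
  shows "P (moved i) x =
    u\<^sup>2 * ((c * t + d) * (t * P a x + P b x) - (a * t + b) * (t * P c x + P d x) + P t x)"
proof -
  define M N where "M = c * t + d" and "N = a * t + b"
  have uM: "u * M = 1" and det: "a * d - b * c = 1"
    using den_relation[of i] det_relation by (simp_all add: assms M_def)
  have "0 = u * P (u * M) x"
    by (simp add: uM P_simps)
  also have "\<dots> = P u x * (u * M) + u\<^sup>2 * P M x"
    by (simp add: P_simps algebra_simps power2_eq_square)
  finally have Pu: "P u x = - u\<^sup>2 * P M x"
    by (simp add: uM eq_neg_iff_add_eq_0)
  \<comment> \<open>This brings both summands of the product rule over the common
    denominator.\<close>
  have "u = u\<^sup>2 * M"
    using uM by (simp add: power2_eq_square mult.assoc)
  moreover have "P (moved i) x = P N x * u + N * P u x"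
    by (simp add: moved_def P_simps N_def assms)
  ultimately have "P (moved i) x = P N x * (u\<^sup>2 * M) - u\<^sup>2 * (N * P M x)"
    by (simp add: Pu)
  also have "\<dots> = u\<^sup>2 * (M * (t * P a x + P b x) - N * (t * P c x + P d x) + (a * d - b * c) * P t x)"
    by (simp add: M_def N_def P_simps algebra_simps)
  finally show ?thesis
    by (simp add: det M_def N_def)
qed

lemma P_moved:
  fixes i j :: 'i
  defines "a \<equiv> gxvar A" and "b \<equiv> gxvar B" and "c \<equiv> gxvar C" and "d \<equiv> gxvar D"
    and "t \<equiv> \<lambda>i. gxvar (T i)" and "u \<equiv> \<lambda>i. gxvar (Den i)"
  shows "P (moved j) (moved i) = (u j)\<^sup>2 * (u i)\<^sup>2 *
    (2 * (t j - t i) * (a * c * t j * t i + b * d + b * c * (t j + t i)) +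
      msubst gxconst t (Br (mvar j) (mvar i)))"
proof -
  have det: "a * d - b * c = 1"
    using det_relation by (simp add: assms)
  have right: "P x (moved i) = (u i)\<^sup>2 * ((c * t i + d) * (t i * P x a + P x b) -
      (a * t i + b) * (t i * P x c + P x d) + P x (t i))" for x i
    unfolding P_antisym[of x] P_moved_left assms by (simp add: algebra_simps)
  have Tt: "P (t j) (t i) = msubst gxconst t (Br (mvar j) (mvar i))"
    using P by (simp add: product_bracket_def Let_def t_def)
  \<comment> \<open>Expanding the brackets among a, b, c, d yields the group term with a factor a d
    - b c.\<close>
  have "P (moved j) (moved i) = (u j)\<^sup>2 * (u i)\<^sup>2 *
    ((a * d - b * c) * (2 * (t j - t i) * (a * c * t j * t i + b * d + b * c * (t j + t i))) +
      P (t j) (t i))"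
    unfolding P_moved_left right assms
    by (simp add: P_coord P_coord' P_self algebra_simps)
  then show ?thesis
    by (simp add: det Tt)
qed

end

text \<open>Covariance is an identity at the generic point; applying the evaluation homomorphism to
  both sides specialises it to every point.\<close>

lemma covariant_eval:
  fixes Br :: "('i, 'k::field_char_0) mpoly \<Rightarrow> ('i, 'k) mpoly \<Rightarrow> ('i, 'k) mpoly"
    and \<iota> :: "'k \<Rightarrow> 'r::comm_ring_1"
  assumes "covariant Br" and \<iota>: "unital_ring_hom \<iota>" and det: "a * d - b * c = 1"
    and den: "\<And>i. u i * (c * t i + d) = 1"
  shows "msubst \<iota> (\<lambda>i. (a * t i + b) * u i) (Br (mvar j) (mvar i)) = (u j)\<^sup>2 * (u i)\<^sup>2 *
    (2 * (t j - t i) * (a * c * t j * t i + b * d + b * c * (t j + t i)) +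
      msubst \<iota> t (Br (mvar j) (mvar i)))"
proof -
  from assms(1) obtain P where P: "product_bracket Br P"
    and cov: "P (moved j) (moved i) = msubst gxconst moved (Br (mvar j) (mvar i))"
    unfolding covariant_def by blast
  define x where "x v = (case v of A \<Rightarrow> a | B \<Rightarrow> b | C \<Rightarrow> c | D \<Rightarrow> d | T i \<Rightarrow> t i | Den i \<Rightarrow> u i)" for v
  have x: "x A * x D - x B * x C = 1" "x (Den i) * (x C * x (T i) + x D) = 1" for i
    by (simp_all add: x_def det den)
  note [simp] = hom_simps[OF unital_ring_hom_eval_funGX[OF \<iota> x]]
    eval_funGX_var[OF \<iota> x] eval_funGX_msubst[OF \<iota> x]
  from arg_cong[OF cov, of "eval_funGX \<iota> x"] show ?thesis
    unfolding P_moved[OF P] by (simp add: moved_def) (simp add: x_def)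
qed


section \<open>Classification of the covariant brackets\<close>

lemma moved_difference:
  fixes a b c d t t' u u' :: "'r::comm_ring_1"
  assumes "a * d - b * c = 1" "u * (c * t + d) = 1" "u' * (c * t' + d) = 1"
  shows "(a * t + b) * u - (a * t' + b) * u' = (t - t') * u * u'"
proof -
  \<comment> \<open>Each fraction is multiplied by the other's u (c t + d) = 1, to reach a common
    denominator.\<close>
  have "(a * t + b) * u - (a * t' + b) * u' =
      (a * t + b) * u * (u' * (c * t' + d)) - (a * t' + b) * u' * (u * (c * t + d))"
    by (simp add: assms(2,3))
  also have "\<dots> = (a * d - b * c) * ((t - t') * u * u')"
    by (simp add: algebra_simps)
  finally show ?thesis by (simp add: assms(1))
qed

text \<open>The term added to the difference of squares is exactly the group term of
  \<open>P_moved\<close>. It arises from the factor t + t', since t - t' transforms without an extra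
  term.\<close>

lemma moved_square_difference:
  fixes a b c d t t' u u' :: "'r::comm_ring_1"
  assumes "a * d - b * c = 1" "u * (c * t + d) = 1" "u' * (c * t' + d) = 1"
  shows "((a * t + b) * u)\<^sup>2 - ((a * t' + b) * u')\<^sup>2 =
    u\<^sup>2 * u'\<^sup>2 * (2 * (t - t') * (a * c * t * t' + b * d + b * c * (t + t')) + (t\<^sup>2 - t'\<^sup>2))"
proof -
  have "(a * t + b) * u + (a * t' + b) * u' =
      (a * t + b) * u * (u' * (c * t' + d)) + (a * t' + b) * u' * (u * (c * t + d))"
    by (simp add: assms(2,3))
  also have "\<dots> = u * u' *
      (2 * (a * c * t * t' + b * d + b * c * (t + t')) + (a * d - b * c) * (t + t'))"
    by (simp add: algebra_simps)
  finally have sum: "(a * t + b) * u + (a * t' + b) * u' =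
      u * u' * (2 * (a * c * t * t' + b * d + b * c * (t + t')) + (t + t'))"
    by (simp add: assms(1))
  have "((a * t + b) * u)\<^sup>2 - ((a * t' + b) * u')\<^sup>2 =
      ((a * t + b) * u - (a * t' + b) * u') * ((a * t + b) * u + (a * t' + b) * u')"
    by (simp add: power2_eq_square algebra_simps)
  then show ?thesis
    unfolding moved_difference[OF assms] sum by (simp add: power2_eq_square algebra_simps)
qed

definition defect ::
    "(('i, 'k::field_char_0) mpoly \<Rightarrow> ('i, 'k) mpoly \<Rightarrow> ('i, 'k) mpoly) \<Rightarrow> 'i \<Rightarrow> 'i \<Rightarrow> ('i, 'k) mpoly"
  where "defect Br j i = Br (mvar j) (mvar i) - (mvar j ^ 2 - mvar i ^ 2)"

text \<open>The defect transforms as a form of weight 2 in \<open>t\<^sub>i\<close>, of weight 2 in \<open>t\<^sub>j\<close>, and of weight 0 in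
  the other variables.\<close>

lemma defect_eval:
  fixes \<iota> :: "'k::field_char_0 \<Rightarrow> 'r::comm_ring_1"
  assumes cov: "covariant Br" and \<iota>: "unital_ring_hom \<iota>" and det: "a * d - b * c = 1"
    and den: "\<And>i. u i * (c * t i + d) = 1"
  shows "msubst \<iota> (\<lambda>i. (a * t i + b) * u i) (defect Br j i) =
    (u j)\<^sup>2 * (u i)\<^sup>2 * msubst \<iota> t (defect Br j i)"
  by (simp only: defect_def msubst_hom_simps[OF \<iota>] msubst_mvar'[OF \<iota>] covariant_eval[OF assms]
      moved_square_difference[OF det den den])
     (simp add: algebra_simps)


subsection \<open>Evaluation at Laurent monomials\<close>

text \<open>Exponent vector of the monomial \<open>m\<close> after each variable is raised to the
  power \<open>e\<close>. Integer exponents make the coordinates invertible, as the action by - 1/t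
  requires.\<close>

definition laurent_expo :: "int \<Rightarrow> ('v \<Rightarrow>\<^sub>0 nat) \<Rightarrow> ('v \<Rightarrow>\<^sub>0 int)"
  where "laurent_expo e m =
    (\<Sum>v\<in>Poly_Mapping.keys m. Poly_Mapping.single v (int (Poly_Mapping.lookup m v) * e))"

definition total_degree :: "('v \<Rightarrow>\<^sub>0 nat) \<Rightarrow> nat"
  where "total_degree m = (\<Sum>v\<in>Poly_Mapping.keys m. Poly_Mapping.lookup m v)"

lemma lookup_laurent_expo:
  "Poly_Mapping.lookup (laurent_expo e m) v = int (Poly_Mapping.lookup m v) * e"
  by (simp add: laurent_expo_def lookup_sum lookup_single when_def in_keys_iff)

lemma laurent_expo_inject: "e \<noteq> 0 \<Longrightarrow> laurent_expo e m = laurent_expo e n \<longleftrightarrow> m = n"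
  by (auto simp: poly_mapping_eq_iff fun_eq_iff lookup_laurent_expo)

lemma msubst_laurent:
  fixes p :: "('v, 'k::comm_ring_1) mpoly"
  shows "msubst (Poly_Mapping.single 0) (\<lambda>v. Poly_Mapping.single (Poly_Mapping.single v e) r) p =
    (\<Sum>m\<in>Poly_Mapping.keys p.
      Poly_Mapping.single (laurent_expo e m) (Poly_Mapping.lookup p m * r ^ total_degree m))"
proof -
  have pow: "Poly_Mapping.single (Poly_Mapping.single v e) r ^ n =
      Poly_Mapping.single (Poly_Mapping.single v (int n * e)) (r ^ n)" for v :: 'v and n
    by (induction n) (simp_all add: mult_single algebra_simps flip: single_add)
  have "(\<Prod>v\<in>S. Poly_Mapping.single (Poly_Mapping.single v e) r ^ Poly_Mapping.lookup m v) =
      Poly_Mapping.single (\<Sum>v\<in>S. Poly_Mapping.single v (int (Poly_Mapping.lookup m v) * e))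
        (r ^ (\<Sum>v\<in>S. Poly_Mapping.lookup m v))" if "finite S" for S and m :: "'v \<Rightarrow>\<^sub>0 nat"
    using that by induction (simp_all add: pow mult_single power_add)
  then show ?thesis
    by (simp add: msubst_def laurent_expo_def total_degree_def mult_single)
qed

lemma lookup_sum_single_inj:
  assumes "finite S" "inj_on f S" "m \<in> S"
  shows "Poly_Mapping.lookup (\<Sum>n\<in>S. Poly_Mapping.single (f n) (g n)) (f m) = g m"
proof -
  have "Poly_Mapping.lookup (\<Sum>n\<in>S. Poly_Mapping.single (f n) (g n)) (f m) =
      (\<Sum>n\<in>S. if n = m then g n else 0)"
    unfolding lookup_sum using assms(2,3)
    by (intro sum.cong) (auto simp: lookup_single when_def inj_on_def)
  then show ?thesis using assms by simp
qed

text \<open>For \<open>e \<noteq> 0\<close> distinct monomials keep distinct exponents, so nothing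
  cancels and each coefficient can be read off separately.\<close>

lemma lookup_msubst_laurent:
  fixes p :: "('v, 'k::comm_ring_1) mpoly"
  assumes "e \<noteq> 0" "m \<in> Poly_Mapping.keys p"
  shows "Poly_Mapping.lookup (msubst (Poly_Mapping.single 0)
      (\<lambda>v. Poly_Mapping.single (Poly_Mapping.single v e) r) p) (laurent_expo e m) =
    Poly_Mapping.lookup p m * r ^ total_degree m"
  unfolding msubst_laurent using assms
  by (intro lookup_sum_single_inj) (auto simp: inj_on_def laurent_expo_inject)

section \<open>Monomials and coefficients of the defect\<close>

context
  fixes Br :: "('i, 'k::field_char_0) mpoly \<Rightarrow> ('i, 'k) mpoly \<Rightarrow> ('i, 'k) mpoly"
  assumes cov: "covariant Br"
begin

text \<open>Evaluate at the group element \<open>diag(2, 1/2)\<close>, which acts by \<open>t \<mapsto> 4 t\<close>.\<close>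

lemma total_degree_defect:
  assumes "m \<in> Poly_Mapping.keys (defect Br j i)"
  shows "total_degree m = 2"
proof -
  let ?\<iota> = "Poly_Mapping.single (0 :: 'i \<Rightarrow>\<^sub>0 int) :: 'k \<Rightarrow> _"
  let ?t = "\<lambda>r k. Poly_Mapping.single (Poly_Mapping.single k (1::int)) (r::'k)"
  let ?p = "defect Br j i"
  have "msubst ?\<iota> (\<lambda>k. (?\<iota> 2 * ?t 1 k + 0) * ?\<iota> 2) ?p = (?\<iota> 2)\<^sup>2 * (?\<iota> 2)\<^sup>2 * msubst ?\<iota> (?t 1) ?p"
    by (rule defect_eval[OF cov unital_ring_hom_single_zero, where c = 0 and d = "?\<iota> (1 / 2)"])
       (simp_all add: mult_single del: single_numeral)
  also have "\<dots> = (\<Sum>m\<in>Poly_Mapping.keys ?p.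
      Poly_Mapping.single (laurent_expo 1 m) (16 * Poly_Mapping.lookup ?p m))"
    by (simp add: msubst_laurent mult_single power2_eq_square sum_distrib_left del: single_numeral)
  finally have "msubst ?\<iota> (?t 4) ?p = (\<Sum>m\<in>Poly_Mapping.keys ?p.
      Poly_Mapping.single (laurent_expo 1 m) (16 * Poly_Mapping.lookup ?p m))"
    by (simp add: mult_single del: single_numeral)
  from arg_cong[OF this, of "\<lambda>q. Poly_Mapping.lookup q (laurent_expo 1 m)"]
  have "Poly_Mapping.lookup ?p m * 4 ^ total_degree m = 16 * Poly_Mapping.lookup ?p m"
    using assms lookup_sum_single_inj[of "Poly_Mapping.keys ?p" "laurent_expo 1" m
        "\<lambda>m. 16 * Poly_Mapping.lookup ?p m"]
    by (simp add: lookup_msubst_laurent inj_on_def laurent_expo_inject)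
  \<comment> \<open>The 16 is 2^2 * 2^2, from the two weights with \<open>u = 2\<close>. In
    characteristic 0 the comparison of powers of 4 can be made among naturals.\<close>
  then have "(of_nat (4 ^ total_degree m) :: 'k) = of_nat (4 ^ 2)"
    using assms by (simp add: in_keys_iff)
  then have "(4::nat) ^ total_degree m = 4 ^ 2"
    unfolding of_nat_eq_iff .
  then show ?thesis by (simp only: power_inject_exp)
qed

text \<open>Evaluate at the group element acting by \<open>t \<mapsto> - 1 / t\<close>: it sends an exponent \<open>m\<close> to \<open>- m\<close>, while
  the weights shift exponents by \<open>- 2 e\<^sub>i - 2 e\<^sub>j\<close>.\<close>

lemma lookup_defect_le:
  assumes "m \<in> Poly_Mapping.keys (defect Br j i)"
  shows "Poly_Mapping.lookup m v \<le> (if v = i then 2 else 0) + (if v = j then 2 else 0)"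
proof -
  let ?\<iota> = "Poly_Mapping.single (0 :: 'i \<Rightarrow>\<^sub>0 int) :: 'k \<Rightarrow> _"
  let ?t = "\<lambda>e r k. Poly_Mapping.single (Poly_Mapping.single k (e::int)) (r::'k)"
  let ?p = "defect Br j i"
  let ?s = "Poly_Mapping.single j (-2) + Poly_Mapping.single i (-2) :: 'i \<Rightarrow>\<^sub>0 int"
  have "msubst ?\<iota> (\<lambda>k. (0 * ?t 1 1 k + 1) * ?t (-1) (-1) k) ?p =
      (?t (-1) (-1) j)\<^sup>2 * (?t (-1) (-1) i)\<^sup>2 * msubst ?\<iota> (?t 1 1) ?p"
    by (rule defect_eval[OF cov unital_ring_hom_single_zero, where c = "-1" and d = 0])
       (simp_all add: mult_single flip: single_add single_uminus)
  also have "\<dots> = (\<Sum>m\<in>Poly_Mapping.keys ?p.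
      Poly_Mapping.single (?s + laurent_expo 1 m) (Poly_Mapping.lookup ?p m))"
    by (simp add: msubst_laurent mult_single power2_eq_square sum_distrib_left flip: single_add)
  finally have eq: "msubst ?\<iota> (?t (-1) (-1)) ?p = (\<Sum>m\<in>Poly_Mapping.keys ?p.
      Poly_Mapping.single (?s + laurent_expo 1 m) (Poly_Mapping.lookup ?p m))"
    by simp
  have "Poly_Mapping.lookup ?p m * (-1) ^ total_degree m \<noteq> 0"
    using assms by (simp add: in_keys_iff)
  then have "Poly_Mapping.lookup (msubst ?\<iota> (?t (-1) (-1)) ?p) (laurent_expo (-1) m) \<noteq> 0"
    using assms by (subst lookup_msubst_laurent) simp_all
  then obtain n where "Poly_Mapping.lookup (Poly_Mapping.single (?s + laurent_expo 1 n)
      (Poly_Mapping.lookup ?p n)) (laurent_expo (-1) m) \<noteq> 0"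
    unfolding eq lookup_sum by (rule sum.not_neutral_contains_not_neutral)
  then have "laurent_expo (-1) m = ?s + laurent_expo 1 n"
    by (metis lookup_single_not_eq)
  \<comment> \<open>At \<open>v\<close> this equates - m_v with n_v minus 2 for each of
    \<open>i\<close>, \<open>j\<close> that equals \<open>v\<close>; the bound is n_v \<ge>
    0.\<close>
  from arg_cong[OF this, of "\<lambda>q. Poly_Mapping.lookup q v"] show ?thesis
    by (auto simp: lookup_laurent_expo lookup_add lookup_single when_def split: if_splits)
qed

lemma defect_monomials:
  assumes "i \<noteq> j" "m \<in> Poly_Mapping.keys (defect Br j i)"
  shows "m \<in> {Poly_Mapping.single i 2, Poly_Mapping.single i 1 + Poly_Mapping.single j 1,
    Poly_Mapping.single j 2}"
proof -
  have other: "Poly_Mapping.lookup m v = 0" if "v \<noteq> i" "v \<noteq> j" for v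
    using lookup_defect_le[OF assms(2), of v] that by simp
  then have "Poly_Mapping.keys m \<subseteq> {i, j}"
    by (auto simp: in_keys_iff)
  then have "total_degree m = (\<Sum>v\<in>{i, j}. Poly_Mapping.lookup m v)"
    unfolding total_degree_def by (intro sum.mono_neutral_left) (auto simp: in_keys_iff)
  then have "Poly_Mapping.lookup m i + Poly_Mapping.lookup m j = 2"
    using total_degree_defect[OF assms(2)] assms(1) by simp
  have eqI: "m = n" if "\<And>v. v \<noteq> i \<Longrightarrow> v \<noteq> j \<Longrightarrow> Poly_Mapping.lookup n v = 0"
    "Poly_Mapping.lookup m i = Poly_Mapping.lookup n i"
    "Poly_Mapping.lookup m j = Poly_Mapping.lookup n j" for n
    by (rule poly_mapping_eqI) (metis other that)
  from \<open>Poly_Mapping.lookup m i + Poly_Mapping.lookup m j = 2\<close>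
  consider "Poly_Mapping.lookup m i = 2 \<and> Poly_Mapping.lookup m j = 0"
    | "Poly_Mapping.lookup m i = 1 \<and> Poly_Mapping.lookup m j = 1"
    | "Poly_Mapping.lookup m i = 0 \<and> Poly_Mapping.lookup m j = 2"
    by linarith
  then show ?thesis
  proof cases
    case 1
    then have "m = Poly_Mapping.single i 2"
      using assms(1) by (intro eqI) (auto simp: lookup_single when_def)
    then show ?thesis by simp
  next
    case 2
    then have "m = Poly_Mapping.single i 1 + Poly_Mapping.single j 1"
      using assms(1) by (intro eqI) (auto simp: lookup_add lookup_single when_def)
    then show ?thesis by simp
  next
    case 3
    then have "m = Poly_Mapping.single j 2"
      using assms(1) by (intro eqI) (auto simp: lookup_single when_def)
    then show ?thesis by simp
  qed
qed

lemma defect_eq: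
  assumes "i \<noteq> j"
  shows "\<exists>p. defect Br j i = mconst p * (mvar i - mvar j) ^ 2"
proof -
  let ?l = "Poly_Mapping.lookup (defect Br j i)"
  let ?m = "Poly_Mapping.single i 1 + Poly_Mapping.single j (1::nat)"
  define p q r where "p = ?l (Poly_Mapping.single i 2)" and "q = ?l ?m"
    and "r = ?l (Poly_Mapping.single j 2)"
  have "Poly_Mapping.lookup (Poly_Mapping.single i (2::nat)) i \<noteq> Poly_Mapping.lookup ?m i"
    "Poly_Mapping.lookup (Poly_Mapping.single j (2::nat)) j \<noteq> Poly_Mapping.lookup ?m j"
    "Poly_Mapping.lookup (Poly_Mapping.single i (2::nat)) i \<noteq>
      Poly_Mapping.lookup (Poly_Mapping.single j (2::nat)) i"
    using assms by (auto simp: lookup_add lookup_single when_def)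
  then have distinct: "Poly_Mapping.single i 2 \<noteq> ?m" "Poly_Mapping.single j 2 \<noteq> ?m"
    "Poly_Mapping.single i (2::nat) \<noteq> Poly_Mapping.single j 2"
    by metis+
  have "defect Br j i = (\<Sum>m\<in>{Poly_Mapping.single i 2, ?m, Poly_Mapping.single j 2}.
      Poly_Mapping.single m (?l m))"
    by (subst mpoly_sum_singles, rule sum.mono_neutral_left)
       (use defect_monomials[OF assms] in \<open>auto simp: in_keys_iff\<close>)
  also have "\<dots> = Poly_Mapping.single (Poly_Mapping.single i 2) p + Poly_Mapping.single ?m q +
      Poly_Mapping.single (Poly_Mapping.single j 2) r"
    using distinct distinct[symmetric] by (simp add: p_def q_def r_def)
  also have "\<dots> = mconst p * mvar i ^ 2 + mconst q * (mvar i * mvar j) + mconst r * mvar j ^ 2"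
    unfolding mvar_power by (simp add: mconst_def mvar_def mult_single)
  finally have eq: "defect Br j i =
    mconst p * mvar i ^ 2 + mconst q * (mvar i * mvar j) + mconst r * mvar j ^ 2" .
  have val: "msubst (\<lambda>c. c) t (defect Br j i) = p * t i ^ 2 + q * (t i * t j) + r * t j ^ 2" for t
    unfolding eq by (simp add: msubst_hom_simps[OF unital_ring_hom_id] msubst_mvar'[OF unital_ring_hom_id]
        msubst_mconst'[OF unital_ring_hom_id])
  have shift: "msubst (\<lambda>c. c) (\<lambda>k. t k + 1) (defect Br j i) = msubst (\<lambda>c. c) t (defect Br j i)" for t
    using defect_eval[OF cov unital_ring_hom_id, where a = 1 and b = 1 and c = 0 and d = 1
        and u = "\<lambda>_. 1"]
    by simp
  \<comment> \<open>Translating (t_i, t_j) from (0, 0) to (1, 1), and then from (1, 0) to (2, 1),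
    gives two linear equations that determine \<open>q\<close> and \<open>r\<close> from
    \<open>p\<close>.\<close>
  have "p + q + r = 0"
    using shift[of "\<lambda>_. 0"] by (simp add: val)
  moreover have "4 * p + 2 * q + r = p"
    using shift[of "\<lambda>k. if k = i then 1 else 0"] assms by (simp add: val mult.commute)
  moreover have "p + q + r = 0 \<Longrightarrow> 4 * p + 2 * q + r = p \<Longrightarrow> q = - 2 * p \<and> r = p"
    by algebra
  ultimately have "q = - 2 * p" "r = p" by blast+
  then have "defect Br j i = mconst p * (mvar i - mvar j) ^ 2"
    unfolding eq
    by (simp add: hom_simps[OF unital_ring_hom_mconst] power2_eq_square algebra_simps)
  then show ?thesis ..
qed

end

section \<open>The two inclusions of the classification\<close>

lemma mconst_mult_square_eq_zeroD:
  fixes c :: "'k::field"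
  assumes "i \<noteq> j" "mconst c * (mvar i - mvar j) ^ 2 = 0"
  shows "c = 0"
proof -
  have "msubst (\<lambda>c. c) (\<lambda>k. if k = i then 1 else 0) (mconst c * (mvar i - mvar j) ^ 2) = c"
    using assms(1)
    by (simp add: msubst_hom_simps[OF unital_ring_hom_id] msubst_mvar'[OF unital_ring_hom_id]
        msubst_mconst'[OF unital_ring_hom_id])
  then show ?thesis
    by (simp add: assms(2))
qed

lemma bracket_formula_of_covariant:
  fixes Br :: "('i, 'k::field_char_0) mpoly \<Rightarrow> ('i, 'k) mpoly \<Rightarrow> ('i, 'k) mpoly"
  assumes pp: "pre_poisson mconst Br" and cov: "covariant Br"
  shows "\<exists>\<Lambda>. (\<forall>i j. \<Lambda> i j = - \<Lambda> j i) \<and> bracket_formula \<Lambda> Br"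
proof -
  have "\<forall>i j. \<exists>p. i \<noteq> j \<longrightarrow> defect Br j i = mconst p * (mvar i - mvar j) ^ 2"
    using defect_eq[OF cov] by blast
  then obtain p where p: "i \<noteq> j \<Longrightarrow> defect Br j i = mconst (p i j) * (mvar i - mvar j) ^ 2" for i j
    by metis
  \<comment> \<open>On the diagonal (t_i - t_j)^2 vanishes and says nothing about the coefficient;
    antisymmetry forces the value 0 there.\<close>
  define \<Lambda> where "\<Lambda> i j = (if i = j then 0 else - p i j)" for i j
  have diag: "Br (mvar i) (mvar i) = 0" for i
  \<comment> \<open>Division by 2 takes place coefficient by coefficient, in the field of
    scalars.\<close>
  proof (rule poly_mapping_eqI)
    fix m
    have "Poly_Mapping.lookup (Br (mvar i) (mvar i)) m = - Poly_Mapping.lookup (Br (mvar i) (mvar i)) m"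
      using arg_cong[OF pp_antisym[OF pp, of "mvar i" "mvar i"], of "\<lambda>q. Poly_Mapping.lookup q m"]
      by simp
    then have "2 * Poly_Mapping.lookup (Br (mvar i) (mvar i)) m = 0"
      by (simp only: mult_2 eq_neg_iff_add_eq_0)
    then show "Poly_Mapping.lookup (Br (mvar i) (mvar i)) m = Poly_Mapping.lookup 0 m"
      by simp
  qed
  have formula: "Br (mvar j) (mvar i) =
      mvar j ^ 2 - mvar i ^ 2 - mconst (\<Lambda> i j) * (mvar i - mvar j) ^ 2" for i j
  proof (cases "i = j")
    case False
    from p[OF this] show ?thesis
      using False by (simp add: defect_def \<Lambda>_def hom_simps[OF unital_ring_hom_mconst] algebra_simps)
  qed (simp add: diag)
  have "\<Lambda> i j = - \<Lambda> j i" for i j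
  proof (cases "i = j")
    case False
    have "Br (mvar j) (mvar i) + Br (mvar i) (mvar j) = 0"
      using pp_antisym[OF pp, of "mvar j" "mvar i"] by simp
    then have "mconst (\<Lambda> i j + \<Lambda> j i) * (mvar i - mvar j) ^ 2 = (0 :: ('i, 'k) mpoly)"
      unfolding formula
      by (simp add: hom_simps[OF unital_ring_hom_mconst] power2_eq_square algebra_simps)
    from mconst_mult_square_eq_zeroD[OF False this] show ?thesis
      by (simp add: eq_neg_iff_add_eq_0)
  qed (simp add: \<Lambda>_def)
  with formula show ?thesis
    unfolding bracket_formula_def by blast
qed

text \<open>The part t_j^2 - t_i^2 absorbs the group term of \<open>P_moved\<close>, while (t_i -
  t_j)^2 is merely multiplied by the common factor, so its coefficient is arbitrary.\<close>

lemma covariant_of_bracket_formula: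
  fixes Br :: "('i, 'k::field_char_0) mpoly \<Rightarrow> ('i, 'k) mpoly \<Rightarrow> ('i, 'k) mpoly"
  assumes pp: "pre_poisson mconst Br" and formula: "bracket_formula \<Lambda> Br"
  shows "covariant Br"
proof -
  obtain P where P: "product_bracket Br P"
    using product_bracket_exists[OF pp] ..
  have "P (moved j) (moved i) = msubst gxconst moved (Br (mvar j) (mvar i))" for i j
  proof -
    let ?t = "\<lambda>i. gxvar (T i) :: ('i, 'k) funGX" and ?u = "\<lambda>i. gxvar (Den i) :: ('i, 'k) funGX"
    note rels = det_relation den_relation den_relation
    have square: "(moved i - moved j)\<^sup>2 = (?u j)\<^sup>2 * (?u i)\<^sup>2 * (?t i - ?t j)\<^sup>2"
      unfolding moved_def moved_difference[OF rels]
      by (simp add: power2_eq_square algebra_simps)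
    have Br: "Br (mvar j) (mvar i) =
        mvar j ^ 2 - mvar i ^ 2 - mconst (\<Lambda> i j) * (mvar i - mvar j) ^ 2"
      using formula by (simp add: bracket_formula_def)
    show ?thesis
      by (simp only: P_moved[OF P] Br square moved_square_difference[OF rels, folded moved_def] msubst_hom_simps[OF unital_ring_hom_gxconst]
          msubst_mvar'[OF unital_ring_hom_gxconst] msubst_mconst'[OF unital_ring_hom_gxconst])
         (simp add: algebra_simps)
  qed
  with P show ?thesis
    unfolding covariant_def by blast
qed


section \<open>The Jacobi identity\<close>

definition jacobiator :: "('r::comm_ring_1 \<Rightarrow> 'r \<Rightarrow> 'r) \<Rightarrow> 'r \<Rightarrow> 'r \<Rightarrow> 'r \<Rightarrow> 'r"
  where "jacobiator Br f g h = Br f (Br g h) + Br g (Br h f) + Br h (Br f g)"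

lemma jacobiator_cyclic: "jacobiator Br f g h = jacobiator Br g h f"
  by (simp add: jacobiator_def algebra_simps)

text \<open>The passage from variables to polynomials is made in the first argument only; cyclic
  symmetry brings the other arguments into that position.\<close>

lemma jacobiator_eq_zeroI:
  assumes pp: "pre_poisson mconst Br"
    and var: "\<And>i j k. jacobiator Br (mvar i) (mvar j) (mvar k) = 0"
  shows "jacobiator Br f g h = 0"
proof -
  have step: "jacobiator Br f g h = 0" if "\<And>i. jacobiator Br (mvar i) g h = 0" for f g h
  proof (induction f rule: mpoly_induct)
    case (const c)
    show ?case by (simp add: jacobiator_def pp_simps[OF pp])
  next
    case (add p q)
    have "jacobiator Br (p + q) g h = jacobiator Br p g h + jacobiator Br q g h"
      by (simp add: jacobiator_def pp_simps[OF pp] algebra_simps)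
    then show ?case by (simp add: add)
  next
    case (mult p q)
    \<comment> \<open>The mixed products of two brackets, such as {h,p} {g,q} and {h,p} {q,g},
      cancel by antisymmetry.\<close>
    have "jacobiator Br (p * q) g h = jacobiator Br p g h * q + p * jacobiator Br q g h"
      by (simp add: jacobiator_def pp_simps[OF pp] pp_antisym[OF pp, of p g] pp_antisym[OF pp, of q g]
          algebra_simps)
    then show ?case by (simp add: mult)
  qed (rule that)
  have one: "jacobiator Br f (mvar j) (mvar k) = 0" for f j k
    by (rule step) (rule var)
  have two: "jacobiator Br f g (mvar k) = 0" for f g k
  proof -
    have "jacobiator Br g (mvar k) f = 0"
      by (rule step) (simp only: jacobiator_cyclic[of Br f, symmetric] one)
    then show ?thesis by (simp only: jacobiator_cyclic[of Br f g])
  qed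
  have "jacobiator Br h f g = 0"
    by (rule step) (metis two jacobiator_cyclic)
  then show ?thesis by (simp only: jacobiator_cyclic[of Br h f])
qed

lemma jacobiator_mvar:
  assumes pp: "pre_poisson mconst Br" and antisym: "\<And>i j. \<Lambda> i j = - \<Lambda> j i"
    and formula: "bracket_formula \<Lambda> Br"
  shows "jacobiator Br (mvar i) (mvar j) (mvar k) =
    mconst (- 2 * (1 + \<Lambda> i j * \<Lambda> j k - \<Lambda> i j * \<Lambda> i k - \<Lambda> i k * \<Lambda> j k)) *
      ((mvar i - mvar j) * (mvar j - mvar k) * (mvar k - mvar i))"
proof -
  \<comment> \<open>The formula is stated for both orders of the arguments, so that only
    \<open>\<Lambda> i j\<close>, \<open>\<Lambda> j k\<close> and \<open>\<Lambda> i k\<close>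
    occur in the computation.\<close>
  have Br: "Br (mvar i) (mvar j) =
      mvar i ^ 2 - mvar j ^ 2 + mconst (\<Lambda> i j) * (mvar i - mvar j) ^ 2" for i j
    using formula antisym[of i j]
    by (simp add: bracket_formula_def hom_simps[OF unital_ring_hom_mconst] power2_commute)
  have Br': "Br (mvar j) (mvar i) =
      mvar j ^ 2 - mvar i ^ 2 - mconst (\<Lambda> i j) * (mvar i - mvar j) ^ 2" for i j
    using formula by (simp add: bracket_formula_def)
  show ?thesis
    unfolding jacobiator_def Br[of i j] Br[of j k] Br'[of k i]
    by (simp add: pp_simps[OF pp] Br[of i j] Br[of j k] Br[of i k] Br'[of j i] Br'[of k j] Br'[of k i]
        hom_simps[OF unital_ring_hom_mconst])
       (simp add: power2_eq_square algebra_simps)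
qed

lemma poisson_iff:
  fixes Br :: "('i, 'k::field_char_0) mpoly \<Rightarrow> ('i, 'k) mpoly \<Rightarrow> ('i, 'k) mpoly"
  assumes pp: "pre_poisson mconst Br" and antisym: "\<And>i j. \<Lambda> i j = - \<Lambda> j i"
    and formula: "bracket_formula \<Lambda> Br"
  shows "poisson mconst Br \<longleftrightarrow>
    (\<forall>i j k. i \<noteq> j \<and> j \<noteq> k \<and> i \<noteq> k \<longrightarrow>
      \<Lambda> i j * \<Lambda> j k - \<Lambda> i j * \<Lambda> i k - \<Lambda> i k * \<Lambda> j k = - 1)"
    (is "_ \<longleftrightarrow> ?cond")
proof -
  note jac = jacobiator_mvar[OF pp antisym formula]
  let ?c = "\<lambda>i j k. 1 + \<Lambda> i j * \<Lambda> j k - \<Lambda> i j * \<Lambda> i k - \<Lambda> i k * \<Lambda> j k"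
  have c: "?c i j k = 0 \<longleftrightarrow> \<Lambda> i j * \<Lambda> j k - \<Lambda> i j * \<Lambda> i k - \<Lambda> i k * \<Lambda> j k = - 1" for i j k
    by algebra
  have "poisson mconst Br \<longleftrightarrow> (\<forall>f g h. jacobiator Br f g h = 0)"
    by (simp add: poisson_def jacobiator_def pp)
  also have "\<dots> \<longleftrightarrow> ?cond"
  proof
    assume zero: "\<forall>f g h. jacobiator Br f g h = 0"
    show ?cond
    proof (intro allI impI)
      fix i j k :: 'i
      assume ne: "i \<noteq> j \<and> j \<noteq> k \<and> i \<noteq> k"
      \<comment> \<open>At t_i = 0, t_j = 1, t_k = - 1 the product of differences is 2, so the
        jacobiator takes the value - 4 times the coefficient in question.\<close>
      define t :: "'i \<Rightarrow> 'k" where "t = (\<lambda>v. if v = j then 1 else if v = k then - 1 else 0)"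
      have "0 = msubst (\<lambda>c. c) t (jacobiator Br (mvar i) (mvar j) (mvar k))"
        by (simp add: zero)
      also have "\<dots> = - 4 * ?c i j k"
        unfolding jac
        by (simp only: msubst_hom_simps[OF unital_ring_hom_id] msubst_mvar'[OF unital_ring_hom_id]
            msubst_mconst'[OF unital_ring_hom_id])
           (use ne in \<open>auto simp: t_def\<close>)
      finally have "?c i j k = 0"
        by (metis mult_eq_0_iff neg_equal_0_iff_equal zero_neq_numeral)
      then show "\<Lambda> i j * \<Lambda> j k - \<Lambda> i j * \<Lambda> i k - \<Lambda> i k * \<Lambda> j k = - 1"
        unfolding c .
    qed
  next
    assume cond: ?cond
    have "jacobiator Br (mvar i) (mvar j) (mvar k) = 0" for i j k
    proof (cases "i \<noteq> j \<and> j \<noteq> k \<and> i \<noteq> k")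
      case True
      then have "?c i j k = 0" using cond unfolding c by blast
      then show ?thesis
        unfolding jac by (simp only: mult_zero_right hom_zero[OF unital_ring_hom_mconst] mult_zero_left)
    \<comment> \<open>If two indices coincide, the product of differences is zero.\<close>
    qed (auto simp: jac)
    then show "\<forall>f g h. jacobiator Br f g h = 0"
      using jacobiator_eq_zeroI[OF pp] by blast
  qed
  finally show ?thesis .
qed

text \<open>Antisymmetry of \<open>\<Lambda>\<close> makes the prescribed values on variables
  antisymmetric; these extend to a bracket, and a biderivation is determined by them.\<close>

lemma ex1_bracket_formula:
  assumes antisym: "\<And>i j. \<Lambda> i j = - \<Lambda> j i"
  shows "\<exists>!Br. pre_poisson mconst Br \<and> bracket_formula \<Lambda> Br"
proof -
  define \<pi> :: "'a \<Rightarrow> 'a \<Rightarrow> ('a, 'b) mpoly"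
    where "\<pi> j i = mvar j ^ 2 - mvar i ^ 2 - mconst (\<Lambda> i j) * (mvar i - mvar j) ^ 2" for i j
  have "\<pi> j i = - \<pi> i j" for i j
    using antisym[of i j]
    by (simp add: \<pi>_def hom_simps[OF unital_ring_hom_mconst] power2_commute[of "mvar i"])
  from pre_poisson_ext_bracket[of \<pi>, OF this] show ?thesis
    by (intro ex1I[of _ "ext_bracket mconst mvar \<pi>"])
       (auto simp: bracket_formula_def ext_bracket_mvar[OF unital_ring_hom_mconst] \<pi>_def
         intro!: pre_poisson_eqI)
qed


(* 'k :: real_normed_field covers the scalar fields real and complex *)
theorem mainTheorem1:
  shows "{Br :: ('i, 'k::real_normed_field) mpoly \<Rightarrow> ('i, 'k) mpoly \<Rightarrow> ('i, 'k) mpoly.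
            pre_poisson mconst Br \<and> covariant Br} =
         {Br. pre_poisson mconst Br \<and>
            (\<exists>\<Lambda>. (\<forall>i j. \<Lambda> i j = - \<Lambda> j i) \<and> bracket_formula \<Lambda> Br)}
    \<and> (\<forall>\<Lambda> :: 'i \<Rightarrow> 'i \<Rightarrow> 'k. (\<forall>i j. \<Lambda> i j = - \<Lambda> j i) \<longrightarrow>
         (\<exists>!Br. pre_poisson mconst Br \<and> bracket_formula \<Lambda> Br) \<and>
         (\<forall>Br. pre_poisson mconst Br \<and> bracket_formula \<Lambda> Br \<longrightarrow>
           (poisson mconst Br \<longleftrightarrow>
             (\<forall>i j k. i \<noteq> j \<and> j \<noteq> k \<and> i \<noteq> k \<longrightarrow>
               \<Lambda> i j * \<Lambda> j k - \<Lambda> i j * \<Lambda> i k - \<Lambda> i k * \<Lambda> j k = - 1))))"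
proof (intro conjI allI impI)
  show "{Br :: ('i, 'k) mpoly \<Rightarrow> ('i, 'k) mpoly \<Rightarrow> ('i, 'k) mpoly.
            pre_poisson mconst Br \<and> covariant Br} =
         {Br. pre_poisson mconst Br \<and>
            (\<exists>\<Lambda>. (\<forall>i j. \<Lambda> i j = - \<Lambda> j i) \<and> bracket_formula \<Lambda> Br)}"
    using bracket_formula_of_covariant covariant_of_bracket_formula by blast
next
  fix \<Lambda> :: "'i \<Rightarrow> 'i \<Rightarrow> 'k"
  assume "\<forall>i j. \<Lambda> i j = - \<Lambda> j i"
  then have antisym: "\<And>i j. \<Lambda> i j = - \<Lambda> j i" by blast
  show "\<exists>!Br. pre_poisson mconst Br \<and> bracket_formula \<Lambda> Br"
    by (rule ex1_bracket_formula[OF antisym])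
  show "poisson mconst Br \<longleftrightarrow>
      (\<forall>i j k. i \<noteq> j \<and> j \<noteq> k \<and> i \<noteq> k \<longrightarrow>
        \<Lambda> i j * \<Lambda> j k - \<Lambda> i j * \<Lambda> i k - \<Lambda> i k * \<Lambda> j k = - 1)"
    if "pre_poisson mconst Br \<and> bracket_formula \<Lambda> Br" for Br
    using that poisson_iff antisym by blast
qed

end
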